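(* Let $p$ be a prime, $m\ge0$, and $\gamma=\begin{pmatrix}a&0\\0&b\end{pmatrix}$ with $a,b\in\mathbb{Q}_p^\times$, $a\ne b$; put $k_p=v_p(a-b)$. If $a,b\in\mathbb{Z}_p$ and $|ab|_p=p^{-m}$, then \[ \mathrm{wOrb}(\mathbf{1}_{\mathcal{X}_p^m};\gamma)=\frac{2}{|a-b|_p}\left(\log|a-b|_p+\sum_{j=1}^{k_p}\frac{\log p}{p^j}\right), \] and otherwise $\mathrm{wOrb}(\mathbf{1}_{\mathcal{X}_p^m};\gamma)=0$.
   Context: $G=\mathrm{GL}_2$, $A$ the diagonal torus, $B$ upper triangular Borel, $w=\begin{pmatrix}0&1\\1&0\end{pmatrix}$ (nontrivial Weyl element). $\mathcal{X}_p^m=\{X\in M_2(\mathbb{Z}_p):|\det X|_p=p^{-m}\}$. Harish-Chandra map: writing $g=n\,\mathrm{diag}(x,y)k$ ($n$ upper unipotent, $k\in G(\mathbb{Z}_p)$), $H_B(g)=(\log|x|_p,\log|y|_p)$; $\alpha(H_1,H_2)=H_1-H_2$. Weighted orbital integral: $\mathrm{wOrb}(f;\gamma)=\int_{A(\mathbb{Q}_p)\backslash G(\mathbb{Q}_p)}f(g^{-1}\gamma g)\,\alpha(H_B(wg)+H_B(g))\,dg$, with Haar measures giving $G(\mathbb{Z}_p)$ and $A(\mathbb{Z}_p)=\mathbb{Z}_p^\times\times\mathbb{Z}_p^\times$ volume 1. *)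

theory Defs
  imports "HOL-Analysis.Analysis" "HOL-Computational_Algebra.Primes"
begin

section \<open>The p-adic absolute value on the rationals\<close>

definition padic_val_rat :: "nat \<Rightarrow> rat \<Rightarrow> int" where
  "padic_val_rat p r =
     int (multiplicity (int p) (fst (quotient_of r))) - int (multiplicity (int p) (snd (quotient_of r)))"

definition padic_abs :: "nat \<Rightarrow> rat \<Rightarrow> real" where
  "padic_abs p r = (if r = 0 then 0 else real p powi (- padic_val_rat p r))"

definition padic_cauchy :: "nat \<Rightarrow> (nat \<Rightarrow> rat) \<Rightarrow> bool" where
  "padic_cauchy p X \<longleftrightarrow> (\<forall>e>0. \<exists>N. \<forall>m\<ge>N. \<forall>n\<ge>N. padic_abs p (X m - X n) < e)"

definition padic_null :: "nat \<Rightarrow> (nat \<Rightarrow> rat) \<Rightarrow> bool" where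
  "padic_null p X \<longleftrightarrow> (\<lambda>n. padic_abs p (X n)) \<longlonglongrightarrow> 0"

definition padic_rel :: "nat \<Rightarrow> (nat \<Rightarrow> rat) \<Rightarrow> (nat \<Rightarrow> rat) \<Rightarrow> bool" where
  "padic_rel p X Y \<longleftrightarrow> padic_cauchy p X \<and> padic_cauchy p Y \<and> padic_null p (\<lambda>n. X n - Y n)"

context
  fixes p :: nat
  assumes p: "prime p"
begin

lemma prime_int_p: "prime (int p)"
  using p by simp

lemma padic_abs_quotient:
  fixes a b :: int
  assumes "a \<noteq> 0" "b \<noteq> 0"
  shows "padic_abs p (of_int a / of_int b) =
    real p powi (int (multiplicity (int p) b) - int (multiplicity (int p) a))"
proof -
  define r :: rat where "r = of_int a / of_int b"
  obtain n d where nd: "quotient_of r = (n, d)" by (cases "quotient_of r")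
  have r: "r = of_int n / of_int d" and d: "d > 0"
    using quotient_of_div[OF nd] quotient_of_denom_pos[OF nd] by auto
  have r0: "r \<noteq> 0" using assms by (simp add: r_def)
  then have n: "n \<noteq> 0" using r by auto
  have "(of_int a :: rat) * of_int d = of_int n * of_int b"
    using r assms d by (simp add: r_def frac_eq_eq)
  then have "a * d = n * b"
    by (metis of_int_eq_iff of_int_mult)
  then have "multiplicity (int p) a + multiplicity (int p) d
      = multiplicity (int p) n + multiplicity (int p) b"
    using assms d n prime_int_p
    by (metis less_numeral_extra(3) prime_elem_multiplicity_mult_distrib prime_imp_prime_elem)
  then have "- padic_val_rat p r = int (multiplicity (int p) b) - int (multiplicity (int p) a)"
    by (simp add: padic_val_rat_def nd)
  then show ?thesis using r0 by (simp add: padic_abs_def r_def)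
qed

lemma padic_abs_0 [simp]: "padic_abs p 0 = 0"
  by (simp add: padic_abs_def)

lemma padic_abs_pos: "r \<noteq> 0 \<Longrightarrow> padic_abs p r > 0"
  using p by (simp add: padic_abs_def prime_gt_0_nat)

lemma padic_abs_nonneg [simp]: "padic_abs p r \<ge> 0"
  using padic_abs_pos[of r] by (cases "r = 0") auto

lemma padic_abs_eq_0 [simp]: "padic_abs p r = 0 \<longleftrightarrow> r = 0"
  using padic_abs_pos[of r] by (cases "r = 0") auto

lemma rat_quotient:
  fixes r :: rat
  obtains a b :: int where "r = of_int a / of_int b" "b \<noteq> 0"
  by (metis quotient_of_denom_pos quotient_of_div surj_pair less_irrefl)

lemma padic_abs_mult: "padic_abs p (r * s) = padic_abs p r * padic_abs p s"
proof (cases "r = 0 \<or> s = 0")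
  case False
  obtain a b where r: "r = of_int a / of_int b" "b \<noteq> 0" by (rule rat_quotient)
  obtain c d where s: "s = of_int c / of_int d" "d \<noteq> 0" by (rule rat_quotient)
  have ac: "a \<noteq> 0" "c \<noteq> 0" using False r s by auto
  have rs: "r * s = of_int (a * c) / of_int (b * d)" by (simp add: r s)
  have pe: "prime_elem (int p)" using prime_int_p by blast
  show ?thesis
    unfolding rs unfolding r(1) s(1)
    using r(2) s(2) ac p
    by (simp add: padic_abs_quotient prime_elem_multiplicity_mult_distrib[OF pe]
        power_int_add[symmetric] prime_gt_0_nat algebra_simps del: of_int_mult)
qed auto

lemma padic_abs_1 [simp]: "padic_abs p 1 = 1"
  using padic_abs_quotient[of 1 1] by simp

lemma padic_abs_minus [simp]: "padic_abs p (- r) = padic_abs p r"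
proof -
  have "padic_abs p (-1) = 1" using padic_abs_quotient[of "-1" 1] by (simp add: multiplicity_unit_right)
  then show ?thesis using padic_abs_mult[of "-1" r] by simp
qed

lemma padic_abs_minus_commute: "padic_abs p (r - s) = padic_abs p (s - r)"
  using padic_abs_minus[of "r - s"] by simp

lemma padic_abs_ultra: "padic_abs p (r + s) \<le> max (padic_abs p r) (padic_abs p s)"
proof (cases "r = 0 \<or> s = 0 \<or> r + s = 0")
  case False
  obtain a b where r: "r = of_int a / of_int b" "b \<noteq> 0" by (rule rat_quotient)
  obtain c d where s: "s = of_int c / of_int d" "d \<noteq> 0" by (rule rat_quotient)
  define x y z where "x = a * d" and "y = c * b" and "z = b * d"
  have z: "z \<noteq> 0" using r s by (simp add: z_def)
  have rx: "r = of_int x / of_int z" and sy: "s = of_int y / of_int z"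
    using r s by (simp_all add: x_def y_def z_def)
  have rs: "r + s = of_int (x + y) / of_int z" by (simp add: rx sy add_divide_distrib)
  have nz: "x \<noteq> 0" "y \<noteq> 0" "x + y \<noteq> 0" using False rx sy rs by auto
  define k where "k = min (multiplicity (int p) x) (multiplicity (int p) y)"
  have "int p ^ k dvd x" "int p ^ k dvd y"
    by (auto simp: k_def intro: multiplicity_dvd')
  then have "int p ^ k dvd x + y" by simp
  moreover have "\<not> is_unit (int p)" using prime_int_p not_prime_unit by blast
  ultimately have k: "k \<le> multiplicity (int p) (x + y)"
    using nz by (intro multiplicity_geI)
  have p1: "real p \<ge> 1" using p prime_ge_1_nat by simp
  have "real p powi (int (multiplicity (int p) z) - int (multiplicity (int p) (x + y)))
      \<le> real p powi (int (multiplicity (int p) z) - int k)"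
    by (intro power_int_increasing) (use k p1 in auto)
  also have "\<dots> \<le> max (padic_abs p r) (padic_abs p s)"
    unfolding rx sy padic_abs_quotient[OF nz(1) z] padic_abs_quotient[OF nz(2) z]
    by (auto simp: k_def min_def)
  finally show ?thesis
    unfolding rs padic_abs_quotient[OF nz(3) z] .
qed (auto simp: max_def)

lemma padic_abs_triangle: "padic_abs p (r + s) \<le> padic_abs p r + padic_abs p s"
  using padic_abs_ultra[of r s] padic_abs_nonneg[of r] padic_abs_nonneg[of s] by linarith

lemma padic_abs_diff: "\<bar>padic_abs p r - padic_abs p s\<bar> \<le> padic_abs p (r - s)"
  using padic_abs_triangle[of "r - s" s] padic_abs_triangle[of "s - r" r]
    padic_abs_minus_commute[of r s] by simp

lemma padic_abs_inverse: "padic_abs p (inverse r) = inverse (padic_abs p r)"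
proof (cases "r = 0")
  case False
  then have "padic_abs p r * padic_abs p (inverse r) = 1"
    using padic_abs_mult[of r "inverse r"] by simp
  then show ?thesis by (metis inverse_unique)
qed simp

lemma padic_null_add:
  assumes "padic_null p X" "padic_null p Y"
  shows "padic_null p (\<lambda>n. X n + Y n)"
  unfolding padic_null_def
proof (rule tendsto_sandwich[OF _ _ tendsto_const])
  show "(\<lambda>n. padic_abs p (X n) + padic_abs p (Y n)) \<longlonglongrightarrow> 0"
    using tendsto_add[OF assms[unfolded padic_null_def]] by simp
qed (auto intro: always_eventually padic_abs_triangle)

lemma padic_null_minus: "padic_null p X \<Longrightarrow> padic_null p (\<lambda>n. - X n)"
  by (simp add: padic_null_def)

lemma padic_null_diff:
  "padic_null p X \<Longrightarrow> padic_null p Y \<Longrightarrow> padic_null p (\<lambda>n. X n - Y n)"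
  using padic_null_add[OF _ padic_null_minus, of X Y] by simp

lemma padic_cauchyD:
  assumes "padic_cauchy p X" "e > 0"
  obtains N where "\<And>m n. m \<ge> N \<Longrightarrow> n \<ge> N \<Longrightarrow> padic_abs p (X m - X n) < e"
  using assms unfolding padic_cauchy_def by blast

lemma padic_cauchy_const [simp]: "padic_cauchy p (\<lambda>n. r)"
  by (simp add: padic_cauchy_def)

lemma padic_cauchy_add:
  assumes "padic_cauchy p X" "padic_cauchy p Y"
  shows "padic_cauchy p (\<lambda>n. X n + Y n)"
  unfolding padic_cauchy_def
proof (intro allI impI)
  fix e :: real assume e: "e > 0"
  obtain M where M: "\<And>m n. m \<ge> M \<Longrightarrow> n \<ge> M \<Longrightarrow> padic_abs p (X m - X n) < e"
    using padic_cauchyD[OF assms(1) e] by blast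
  obtain N where N: "\<And>m n. m \<ge> N \<Longrightarrow> n \<ge> N \<Longrightarrow> padic_abs p (Y m - Y n) < e"
    using padic_cauchyD[OF assms(2) e] by blast
  have "padic_abs p (X m + Y m - (X n + Y n)) < e" if "m \<ge> max M N" "n \<ge> max M N" for m n
    using padic_abs_ultra[of "X m - X n" "Y m - Y n"] M[of m n] N[of m n] that
    by (simp add: algebra_simps)
  then show "\<exists>N. \<forall>m\<ge>N. \<forall>n\<ge>N. padic_abs p (X m + Y m - (X n + Y n)) < e" by blast
qed

lemma padic_cauchy_minus: "padic_cauchy p X \<Longrightarrow> padic_cauchy p (\<lambda>n. - X n)"
  unfolding padic_cauchy_def by (simp add: padic_abs_minus_commute)

lemma padic_cauchy_abs_convergent:
  assumes "padic_cauchy p X"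
  shows "convergent (\<lambda>n. padic_abs p (X n))"
proof -
  have "Cauchy (\<lambda>n. padic_abs p (X n))"
  proof (rule metric_CauchyI)
    fix e :: real assume "e > 0"
    then obtain N where "\<And>m n. m \<ge> N \<Longrightarrow> n \<ge> N \<Longrightarrow> padic_abs p (X m - X n) < e"
      using padic_cauchyD[OF assms] by blast
    then show "\<exists>N. \<forall>m\<ge>N. \<forall>n\<ge>N. dist (padic_abs p (X m)) (padic_abs p (X n)) < e"
      by (metis dist_real_def padic_abs_diff order_le_less_trans)
  qed
  then show ?thesis by (rule Cauchy_convergent)
qed

lemma padic_cauchy_bounded:
  assumes "padic_cauchy p X"
  obtains C where "C > 0" "\<And>n. padic_abs p (X n) \<le> C"
proof -
  have "Bseq (\<lambda>n. padic_abs p (X n))"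
    using padic_cauchy_abs_convergent[OF assms] by (rule convergent_imp_Bseq)
  then show ?thesis
    using that unfolding Bseq_def by auto
qed

lemma padic_null_mult_cauchy:
  assumes "padic_null p X" "padic_cauchy p Y"
  shows "padic_null p (\<lambda>n. Y n * X n)"
  unfolding padic_null_def
proof -
  obtain C where C: "C > 0" "\<And>n. padic_abs p (Y n) \<le> C"
    using padic_cauchy_bounded[OF assms(2)] by blast
  show "(\<lambda>n. padic_abs p (Y n * X n)) \<longlonglongrightarrow> 0"
  proof (rule tendsto_sandwich[OF _ _ tendsto_const])
    show "(\<lambda>n. C * padic_abs p (X n)) \<longlonglongrightarrow> 0"
      using tendsto_mult_left[OF assms(1)[unfolded padic_null_def], of C] by simp
  qed (auto intro!: always_eventually mult_right_mono C simp: padic_abs_mult)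
qed

lemma padic_cauchy_mult:
  assumes "padic_cauchy p X" "padic_cauchy p Y"
  shows "padic_cauchy p (\<lambda>n. X n * Y n)"
  unfolding padic_cauchy_def
proof (intro allI impI)
  fix e :: real assume e: "e > 0"
  obtain C where C: "C > 0" "\<And>n. padic_abs p (X n) \<le> C"
    using padic_cauchy_bounded[OF assms(1)] by blast
  obtain D where D: "D > 0" "\<And>n. padic_abs p (Y n) \<le> D"
    using padic_cauchy_bounded[OF assms(2)] by blast
  obtain M where M: "\<And>m n. m \<ge> M \<Longrightarrow> n \<ge> M \<Longrightarrow> padic_abs p (X m - X n) < e / D"
    using padic_cauchyD[OF assms(1)] e D(1) by (meson divide_pos_pos)
  obtain N where N: "\<And>m n. m \<ge> N \<Longrightarrow> n \<ge> N \<Longrightarrow> padic_abs p (Y m - Y n) < e / C"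
    using padic_cauchyD[OF assms(2)] e C(1) by (meson divide_pos_pos)
  have "padic_abs p (X m * Y m - X n * Y n) < e" if "m \<ge> max M N" "n \<ge> max M N" for m n
  proof -
    have "padic_abs p ((X m - X n) * Y m) \<le> padic_abs p (X m - X n) * D"
      by (simp add: padic_abs_mult mult_left_mono D)
    also have "\<dots> < e" using M[of m n] that D(1) by (simp add: pos_less_divide_eq)
    finally have 1: "padic_abs p ((X m - X n) * Y m) < e" .
    have "padic_abs p ((Y m - Y n) * X n) \<le> padic_abs p (Y m - Y n) * C"
      by (simp add: padic_abs_mult mult_left_mono C)
    also have "\<dots> < e" using N[of m n] that C(1) by (simp add: pos_less_divide_eq)
    finally have 2: "padic_abs p ((Y m - Y n) * X n) < e" .
    have "X m * Y m - X n * Y n = (X m - X n) * Y m + (Y m - Y n) * X n"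
      by (simp add: algebra_simps)
    then show ?thesis
      using padic_abs_ultra[of "(X m - X n) * Y m" "(Y m - Y n) * X n"] 1 2 by simp
  qed
  then show "\<exists>N. \<forall>m\<ge>N. \<forall>n\<ge>N. padic_abs p (X m * Y m - X n * Y n) < e" by blast
qed

lemma padic_cauchy_not_null:
  assumes "padic_cauchy p X" "\<not> padic_null p X"
  obtains c N where "c > 0" "\<And>n. n \<ge> N \<Longrightarrow> padic_abs p (X n) \<ge> c"
proof -
  obtain L where L: "(\<lambda>n. padic_abs p (X n)) \<longlonglongrightarrow> L"
    using padic_cauchy_abs_convergent[OF assms(1)] convergent_def by blast
  have "L \<ge> 0" using L by (rule LIMSEQ_le_const) auto
  moreover have "L \<noteq> 0" using L assms(2) by (auto simp: padic_null_def)
  ultimately have "L > L / 2" "L > 0" by auto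
  with order_tendstoD(1)[OF L, of "L/2"]
  obtain N where "\<And>n. n \<ge> N \<Longrightarrow> padic_abs p (X n) > L / 2"
    by (auto simp: eventually_sequentially)
  with \<open>L > 0\<close> show ?thesis using that[of "L/2" N] by (simp add: less_imp_le)
qed

lemma padic_cauchy_inverse:
  assumes "padic_cauchy p X" "\<not> padic_null p X"
  shows "padic_cauchy p (\<lambda>n. inverse (X n))"
  unfolding padic_cauchy_def
proof (intro allI impI)
  fix e :: real assume e: "e > 0"
  obtain c M where c: "c > 0" and M: "\<And>n. n \<ge> M \<Longrightarrow> padic_abs p (X n) \<ge> c"
    using padic_cauchy_not_null[OF assms] by blast
  have "e * c * c > 0" using e c by simp
  then obtain N where N: "\<And>m n. m \<ge> N \<Longrightarrow> n \<ge> N \<Longrightarrow> padic_abs p (X m - X n) < e * c * c"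
    using padic_cauchyD[OF assms(1)] by blast
  have "padic_abs p (inverse (X m) - inverse (X n)) < e" if "m \<ge> max M N" "n \<ge> max M N" for m n
  proof -
    have mn: "padic_abs p (X m) \<ge> c" "padic_abs p (X n) \<ge> c" using M that by auto
    then have nz: "X m \<noteq> 0" "X n \<noteq> 0" using c by auto
    then have eq: "inverse (X m) - inverse (X n) = (X n - X m) * inverse (X m * X n)"
      by (simp add: field_simps)
    have cc: "c * c \<le> padic_abs p (X m) * padic_abs p (X n)"
      using mn c by (intro mult_mono) auto
    have "padic_abs p (X n - X m) < e * (c * c)"
      using N[of n m] that by (simp add: mult.assoc)
    also have "\<dots> \<le> e * (padic_abs p (X m) * padic_abs p (X n))"
      using cc e by (intro mult_left_mono) auto
    finally have "padic_abs p (X n - X m) < e * (padic_abs p (X m) * padic_abs p (X n))" .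
    moreover have "padic_abs p (X m) * padic_abs p (X n) > 0"
      using nz padic_abs_pos by simp
    ultimately show ?thesis
      unfolding eq padic_abs_mult padic_abs_inverse
      by (metis divide_inverse pos_divide_less_eq)
  qed
  then show "\<exists>N. \<forall>m\<ge>N. \<forall>n\<ge>N. padic_abs p (inverse (X m) - inverse (X n)) < e" by blast
qed

lemma padic_null_inverse_diff:
  assumes X: "padic_cauchy p X" "\<not> padic_null p X" and Y: "padic_cauchy p Y" "\<not> padic_null p Y"
    and XY: "padic_null p (\<lambda>n. X n - Y n)"
  shows "padic_null p (\<lambda>n. inverse (X n) - inverse (Y n))"
proof -
  obtain c M where c: "c > 0" and M: "\<And>n. n \<ge> M \<Longrightarrow> padic_abs p (X n) \<ge> c"
    using padic_cauchy_not_null[OF X] by blast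
  obtain d N where d: "d > 0" and N: "\<And>n. n \<ge> N \<Longrightarrow> padic_abs p (Y n) \<ge> d"
    using padic_cauchy_not_null[OF Y] by blast
  have "padic_cauchy p (\<lambda>n. - (inverse (X n) * inverse (Y n)))"
    using X Y by (intro padic_cauchy_minus padic_cauchy_mult padic_cauchy_inverse)
  from padic_null_mult_cauchy[OF XY this]
  have *: "padic_null p (\<lambda>n. - (inverse (X n) * inverse (Y n)) * (X n - Y n))" .
  have "- (inverse (X n) * inverse (Y n)) * (X n - Y n) = inverse (X n) - inverse (Y n)"
    if "n \<ge> max M N" for n
  proof -
    have "X n \<noteq> 0" "Y n \<noteq> 0" using M[of n] N[of n] c d that by auto
    then show ?thesis by (simp add: field_simps)
  qed
  then have "eventually (\<lambda>n. padic_abs p (- (inverse (X n) * inverse (Y n)) * (X n - Y n))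
      = padic_abs p (inverse (X n) - inverse (Y n))) sequentially"
    unfolding eventually_sequentially by metis
  with * show ?thesis
    unfolding padic_null_def by (rule Lim_transform_eventually)
qed

lemma padic_rel_part_equivp: "part_equivp (padic_rel p)"
proof (rule part_equivpI)
  show "\<exists>X. padic_rel p X X"
    by (rule exI[of _ "\<lambda>n. 0"]) (simp add: padic_rel_def padic_null_def)
  show "symp (padic_rel p)"
    by (rule sympI) (auto simp: padic_rel_def padic_null_def padic_abs_minus_commute)
  show "transp (padic_rel p)"
  proof (rule transpI)
    fix X Y Z assume "padic_rel p X Y" "padic_rel p Y Z"
    then show "padic_rel p X Z"
      using padic_null_add[of "\<lambda>n. X n - Y n" "\<lambda>n. Y n - Z n"] by (simp add: padic_rel_def)
  qed
qed

lemma padic_rel_null_iff: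
  assumes "padic_rel p X Y"
  shows "padic_null p X \<longleftrightarrow> padic_null p Y"
  using assms padic_null_diff[of X "\<lambda>n. X n - Y n"] padic_null_add[of "\<lambda>n. X n - Y n" Y]
  by (auto simp: padic_rel_def)

lemma padic_rel_lim:
  assumes "padic_rel p X Y"
  shows "lim (\<lambda>n. padic_abs p (X n)) = lim (\<lambda>n. padic_abs p (Y n))"
proof -
  obtain L where L: "(\<lambda>n. padic_abs p (X n)) \<longlonglongrightarrow> L"
    using padic_cauchy_abs_convergent assms convergent_def padic_rel_def by blast
  have "(\<lambda>n. padic_abs p (X n) - padic_abs p (Y n)) \<longlonglongrightarrow> 0"
  proof (rule Lim_null_comparison)
    show "(\<lambda>n. padic_abs p (X n - Y n)) \<longlonglongrightarrow> 0"
      using assms by (simp add: padic_rel_def padic_null_def)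
  qed (auto intro: always_eventually simp: padic_abs_diff)
  from tendsto_diff[OF L this] have "(\<lambda>n. padic_abs p (Y n)) \<longlonglongrightarrow> L" by simp
  with L show ?thesis by (metis limI)
qed

end

section \<open>The field of p-adic numbers\<close>

text \<open>
  The prime \<open>p\<close> is the cardinality of the type parameter. The field \<open>\<rat>\<^sub>p\<close> is the completion of
  \<open>\<rat>\<close> for the p-adic absolute value, i.e. Cauchy sequences modulo null sequences.
\<close>

class prime_card = finite +
  assumes prime_CARD: "prime CARD('a)"

typedef (overloaded) 'a padic =
    "{C. \<exists>X. padic_cauchy CARD('a::prime_card) X \<and> C = {Y. padic_rel CARD('a) X Y}}"
  by (auto intro: padic_cauchy_const[OF prime_CARD])

definition padic_class :: "(nat \<Rightarrow> rat) \<Rightarrow> 'a::prime_card padic" where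
  "padic_class X = Abs_padic {Y. padic_rel CARD('a) X Y}"

definition padic_rep :: "'a::prime_card padic \<Rightarrow> nat \<Rightarrow> rat" where
  "padic_rep x = (SOME X. X \<in> Rep_padic x)"

lemma padic_rel_refl_iff: "padic_rel CARD('a::prime_card) X X \<longleftrightarrow> padic_cauchy CARD('a) X"
  using prime_CARD[where 'a='a] by (simp add: padic_rel_def padic_null_def)

definition padic_cr :: "(nat \<Rightarrow> rat) \<Rightarrow> 'a::prime_card padic \<Rightarrow> bool" where
  "padic_cr = (\<lambda>X x. padic_rel CARD('a) X X \<and> padic_class X = x)"

lemma Quotient_padic:
  "Quotient (padic_rel CARD('a::prime_card)) padic_class (padic_rep :: 'a padic \<Rightarrow> _) padic_cr"
proof (rule QuotientI)
  show "padic_cr = (\<lambda>X x. padic_rel CARD('a) X X \<and> (padic_class X :: 'a padic) = x)"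
    by (rule padic_cr_def)
next
  note equiv = padic_rel_part_equivp[OF prime_CARD[where 'a='a]]
  note sym = part_equivp_symp[OF equiv] and trans = part_equivp_transp[OF equiv]
  have rep: "padic_rel CARD('a) (padic_rep x) (padic_rep x) \<and> padic_class (padic_rep x) = x"
    for x :: "'a padic"
  proof -
    obtain X where X: "padic_rel CARD('a) X X" "Rep_padic x = {Y. padic_rel CARD('a) X Y}"
      using Rep_padic[of x] by (auto simp: padic_rel_refl_iff)
    then have "padic_rep x \<in> Rep_padic x"
      unfolding padic_rep_def by (metis (full_types) mem_Collect_eq someI)
    then have r: "padic_rel CARD('a) X (padic_rep x)" using X by simp
    then have "{Y. padic_rel CARD('a) (padic_rep x) Y} = Rep_padic x"
      using X(2) sym trans by blast
    then show ?thesis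
      using r sym trans by (metis padic_class_def Rep_padic_inverse)
  qed
  show "padic_class (padic_rep x) = x" for x :: "'a padic" using rep by blast
  show "padic_rel CARD('a) (padic_rep x) (padic_rep x)" for x :: "'a padic" using rep by blast
  fix X Y
  show "padic_rel CARD('a) X Y \<longleftrightarrow> padic_rel CARD('a) X X \<and> padic_rel CARD('a) Y Y \<and>
      (padic_class X :: 'a padic) = padic_class Y"
  proof
    assume XY: "padic_rel CARD('a) X Y"
    then have "{Z. padic_rel CARD('a) X Z} = {Z. padic_rel CARD('a) Y Z}"
      using sym trans by blast
    then show "padic_rel CARD('a) X X \<and> padic_rel CARD('a) Y Y \<and>
        (padic_class X :: 'a padic) = padic_class Y"
      using XY sym trans unfolding padic_class_def by metis
  next
    assume XY: "padic_rel CARD('a) X X \<and> padic_rel CARD('a) Y Y \<and>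
        (padic_class X :: 'a padic) = padic_class Y"
    have "{Z. padic_rel CARD('a) X Z} = {Z. padic_rel CARD('a) Y Z}"
    proof (rule iffD1[OF Abs_padic_inject])
      show "(Abs_padic {Z. padic_rel CARD('a) X Z} :: 'a padic) = Abs_padic {Z. padic_rel CARD('a) Y Z}"
        using XY by (simp add: padic_class_def)
    qed (use XY in \<open>auto simp: padic_rel_refl_iff\<close>)
    then show "padic_rel CARD('a) X Y" using XY by blast
  qed
qed

setup_lifting Quotient_padic

instantiation padic :: (prime_card) field
begin

lift_definition zero_padic :: "'a padic" is "\<lambda>n. 0"
  using prime_CARD[where 'a='a] by (simp add: padic_rel_def padic_null_def)

lift_definition one_padic :: "'a padic" is "\<lambda>n. 1"
  using prime_CARD[where 'a='a] by (simp add: padic_rel_def padic_null_def)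

lift_definition plus_padic :: "'a padic \<Rightarrow> 'a padic \<Rightarrow> 'a padic" is "\<lambda>X Y n. X n + Y n"
  using padic_cauchy_add[OF prime_CARD] padic_null_add[OF prime_CARD]
  by (auto simp: padic_rel_def add_diff_add)

lift_definition uminus_padic :: "'a padic \<Rightarrow> 'a padic" is "\<lambda>X n. - X n"
proof -
  fix X Y :: "nat \<Rightarrow> rat"
  assume "padic_rel CARD('a) X Y"
  then show "padic_rel CARD('a) (\<lambda>n. - X n) (\<lambda>n. - Y n)"
    using padic_cauchy_minus[OF prime_CARD[where 'a='a]]
      padic_null_minus[OF prime_CARD[where 'a='a], of "\<lambda>n. X n - Y n"]
    by (auto simp: padic_rel_def)
qed

lift_definition times_padic :: "'a padic \<Rightarrow> 'a padic \<Rightarrow> 'a padic" is "\<lambda>X Y n. X n * Y n"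
proof -
  fix X X' Y Y' :: "nat \<Rightarrow> rat"
  assume *: "padic_rel CARD('a) X X'" "padic_rel CARD('a) Y Y'"
  have "X n * Y n - X' n * Y' n = Y n * (X n - X' n) + X' n * (Y n - Y' n)" for n
    by (simp add: algebra_simps)
  moreover have "padic_null CARD('a) (\<lambda>n. Y n * (X n - X' n) + X' n * (Y n - Y' n))"
    using * by (auto simp: padic_rel_def
        intro: padic_null_add[OF prime_CARD] padic_null_mult_cauchy[OF prime_CARD])
  ultimately show "padic_rel CARD('a) (\<lambda>n. X n * Y n) (\<lambda>n. X' n * Y' n)"
    using * padic_cauchy_mult[OF prime_CARD[where 'a='a]] by (simp add: padic_rel_def)
qed

lift_definition inverse_padic :: "'a padic \<Rightarrow> 'a padic"
  is "\<lambda>X. if padic_null CARD('a) X then (\<lambda>n. 0) else (\<lambda>n. inverse (X n))"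
proof -
  fix X Y :: "nat \<Rightarrow> rat"
  assume *: "padic_rel CARD('a) X Y"
  note iff = padic_rel_null_iff[OF prime_CARD *]
  show "padic_rel CARD('a)
      (if padic_null CARD('a) X then (\<lambda>n. 0) else (\<lambda>n. inverse (X n)))
      (if padic_null CARD('a) Y then (\<lambda>n. 0) else (\<lambda>n. inverse (Y n)))"
  proof (cases "padic_null CARD('a) X")
    case True
    then show ?thesis
      using iff prime_CARD[where 'a='a] by (simp add: padic_rel_def padic_null_def)
  next
    case False
    then show ?thesis
      using iff * padic_cauchy_inverse[OF prime_CARD[where 'a='a]]
        padic_null_inverse_diff[OF prime_CARD[where 'a='a]]
      by (simp add: padic_rel_def)
  qed
qed

definition "x - y = x + - (y :: 'a padic)"

definition "x div y = x * inverse (y :: 'a padic)"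

instance
proof
  fix a b c :: "'a padic"
  note [simp] = prime_CARD[where 'a='a]
  note c = padic_cauchy_add padic_cauchy_mult padic_cauchy_minus
  show "a + b + c = a + (b + c)"
    by transfer (auto simp: padic_rel_def padic_null_def algebra_simps intro!: c)
  show "a + b = b + a"
    by transfer (auto simp: padic_rel_def padic_null_def algebra_simps intro!: c)
  show "0 + a = a"
    by transfer (auto simp: padic_rel_def padic_null_def algebra_simps intro!: c)
  show "- a + a = 0"
    by transfer (auto simp: padic_rel_def padic_null_def algebra_simps intro!: c)
  show "a - b = a + - b"
    by (rule minus_padic_def)
  show "a * b * c = a * (b * c)"
    by transfer (auto simp: padic_rel_def padic_null_def algebra_simps intro!: c)
  show "a * b = b * a"
    by transfer (auto simp: padic_rel_def padic_null_def algebra_simps intro!: c)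
  show "1 * a = a"
    by transfer (auto simp: padic_rel_def padic_null_def algebra_simps intro!: c)
  show "(a + b) * c = a * c + b * c"
    by transfer (auto simp: padic_rel_def padic_null_def algebra_simps intro!: c)
  show "(0 :: 'a padic) \<noteq> 1"
    by transfer (simp add: padic_rel_def padic_null_def LIMSEQ_const_iff)
  show "inverse (0 :: 'a padic) = 0"
    by transfer (simp add: padic_rel_def padic_null_def)
  show "a div b = a * inverse b"
    by (rule divide_padic_def)
  show "inverse a * a = 1" if "a \<noteq> 0"
    using that
  proof transfer
    fix X assume X: "padic_rel CARD('a) X X" "\<not> padic_rel CARD('a) X (\<lambda>n. 0)"
    then have cX: "padic_cauchy CARD('a) X" and nX: "\<not> padic_null CARD('a) X"
      by (auto simp: padic_rel_def)
    obtain c N where c: "c > 0" and N: "\<And>n. n \<ge> N \<Longrightarrow> padic_abs CARD('a) (X n) \<ge> c"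
      using padic_cauchy_not_null[OF prime_CARD cX nX] by blast
    have "padic_abs CARD('a) (inverse (X n) * X n - 1) = 0" if "n \<ge> N" for n
    proof -
      have "X n \<noteq> 0" using N[OF that] c by auto
      then show ?thesis by simp
    qed
    then have "padic_null CARD('a) (\<lambda>n. inverse (X n) * X n - 1)"
      unfolding padic_null_def
      by (intro tendsto_eventually) (auto simp: eventually_sequentially)
    then show "padic_rel CARD('a)
        (\<lambda>n. (if padic_null CARD('a) X then (\<lambda>n. 0) else (\<lambda>n. inverse (X n))) n * X n) (\<lambda>n. 1)"
      using cX nX by (simp add: padic_rel_def padic_cauchy_mult padic_cauchy_inverse)
  qed
qed

end

lift_definition padic_norm :: "'a::prime_card padic \<Rightarrow> real"
  is "\<lambda>X. lim (\<lambda>n. padic_abs CARD('a) (X n))"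
  by (rule padic_rel_lim[OF prime_CARD])

instantiation padic :: (prime_card) metric_space
begin

definition dist_padic :: "'a padic \<Rightarrow> 'a padic \<Rightarrow> real" where
  "dist_padic x y = padic_norm (x - y)"

definition uniformity_padic :: "('a padic \<times> 'a padic) filter" where
  "uniformity_padic = (INF e\<in>{0<..}. principal {(x, y). dist x y < e})"

definition open_padic :: "'a padic set \<Rightarrow> bool" where
  "open_padic U \<longleftrightarrow> (\<forall>x\<in>U. eventually (\<lambda>(x', y). x' = x \<longrightarrow> y \<in> U) uniformity)"

instance
proof
  note [simp] = prime_CARD[where 'a='a]
  have norm_0: "padic_norm x = 0 \<longleftrightarrow> x = 0" for x :: "'a padic"
  proof transfer
    fix X assume X: "padic_rel CARD('a) X X"
    then have "convergent (\<lambda>n. padic_abs CARD('a) (X n))"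
      by (simp add: padic_rel_def padic_cauchy_abs_convergent)
    then have "lim (\<lambda>n. padic_abs CARD('a) (X n)) = 0 \<longleftrightarrow> padic_null CARD('a) X"
      unfolding padic_null_def by (metis convergent_LIMSEQ_iff limI)
    then show "lim (\<lambda>n. padic_abs CARD('a) (X n)) = 0 \<longleftrightarrow> padic_rel CARD('a) X (\<lambda>n. 0)"
      using X by (simp add: padic_rel_def)
  qed
  have norm_tri: "padic_norm (x + y) \<le> padic_norm x + padic_norm y" for x y :: "'a padic"
  proof transfer
    fix X Y assume "padic_rel CARD('a) X X" "padic_rel CARD('a) Y Y"
    then have XY: "padic_cauchy CARD('a) X" "padic_cauchy CARD('a) Y"
      by (auto simp: padic_rel_def)
    note L = padic_cauchy_abs_convergent[OF prime_CARD, unfolded convergent_LIMSEQ_iff]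
    show "lim (\<lambda>n. padic_abs CARD('a) (X n + Y n))
        \<le> lim (\<lambda>n. padic_abs CARD('a) (X n)) + lim (\<lambda>n. padic_abs CARD('a) (Y n))"
      by (rule LIMSEQ_le[OF L[OF padic_cauchy_add[OF prime_CARD XY]]
            tendsto_add[OF L[OF XY(1)] L[OF XY(2)]]])
        (simp add: padic_abs_triangle)
  qed
  have norm_minus: "padic_norm (- x) = padic_norm x" for x :: "'a padic"
    by transfer simp
  fix x y z :: "'a padic"
  show "dist x y = 0 \<longleftrightarrow> x = y"
    by (simp add: dist_padic_def norm_0)
  have "dist x y \<le> padic_norm (x - z) + padic_norm (- (y - z))"
    using norm_tri[of "x - z" "- (y - z)"] by (simp add: dist_padic_def)
  then show "dist x y \<le> dist x z + dist y z"
    by (simp only: norm_minus dist_padic_def)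
qed (simp_all only: uniformity_padic_def open_padic_def)

end

text \<open>
  The normalized valuation of a nonzero element, characterized by \<open>|x| = p^(-v)\<close>.
\<close>

definition padic_val :: "'p::prime_card padic \<Rightarrow> int" where
  "padic_val x = (THE v. padic_norm x = real CARD('p) powi (- v))"

definition padic_integers :: "'p::prime_card padic set" where
  "padic_integers = {x. padic_norm x \<le> 1}"

section \<open>Matrix groups\<close>

definition diag2 :: "'a::zero \<Rightarrow> 'a \<Rightarrow> 'a^2^2" where
  "diag2 x y = vector [vector [x, 0], vector [0, y]]"

definition weyl :: "'a::zero_neq_one^2^2" where
  "weyl = vector [vector [0, 1], vector [1, 0]]"

definition upper_unipotent :: "'a::zero_neq_one \<Rightarrow> 'a^2^2" where
  "upper_unipotent t = vector [vector [1, t], vector [0, 1]]"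

definition GL2 :: "('a::field^2^2) set" where
  "GL2 = {g. invertible g}"

definition torus :: "('a::field^2^2) set" where
  "torus = {diag2 x y | x y. x \<noteq> 0 \<and> y \<noteq> 0}"

definition GL2_integral :: "('p::prime_card padic^2^2) set" where
  "GL2_integral = {k. (\<forall>i j. k $ i $ j \<in> padic_integers) \<and> padic_norm (det k) = 1}"

definition torus_integral :: "('p::prime_card padic^2^2) set" where
  "torus_integral = {diag2 x y | x y. padic_norm x = 1 \<and> padic_norm y = 1}"

definition det_level :: "nat \<Rightarrow> ('p::prime_card padic^2^2) set" where
  "det_level m =
     {X. (\<forall>i j. X $ i $ j \<in> padic_integers) \<and> padic_norm (det X) = real CARD('p) powi (- int m)}"

section \<open>Haar measures and the quotient measure\<close>

text \<open>
  Left Haar measures on a locally compact, second countable group \<open>G\<close> of matrices with the subspace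
  topology. Regularity is automatic for such groups and is therefore not listed.
\<close>

definition haar_measure :: "('a::{semiring_1,topological_space}^'n^'n) set \<Rightarrow> ('a^'n^'n) measure \<Rightarrow> bool" where
  "haar_measure G \<mu> \<longleftrightarrow>
     sets \<mu> = sets (restrict_space borel G) \<and>
     emeasure \<mu> G \<noteq> 0 \<and>
     (\<forall>C. compact C \<and> C \<subseteq> G \<longrightarrow> emeasure \<mu> C < \<infinity>) \<and>
     (\<forall>g\<in>G. \<forall>E\<in>sets \<mu>. emeasure \<mu> ((\<lambda>h. g ** h) ` E) = emeasure \<mu> E)"

definition right_cosets :: "('a::semiring_1^'n^'n) set \<Rightarrow> ('a^'n^'n) set \<Rightarrow> ('a^'n^'n) set set" where
  "right_cosets H G = (\<lambda>g. (\<lambda>h. h ** g) ` H) ` G"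

definition coset_rep :: "'a set \<Rightarrow> 'a" where
  "coset_rep S = (SOME g. g \<in> S)"

text \<open>
  The Borel sets of \<open>H\G\<close> for the quotient topology: a set of cosets is open iff its preimage, which
  is its union, is open in \<open>G\<close>.
\<close>

definition quotient_borel ::
    "('a::{semiring_1,topological_space}^'n^'n) set \<Rightarrow> ('a^'n^'n) set \<Rightarrow> ('a^'n^'n) set measure" where
  "quotient_borel H G =
     sigma (right_cosets H G) {U. U \<subseteq> right_cosets H G \<and> openin (top_of_set G) (\<Union>U)}"

text \<open>
  The measure on \<open>H\G\<close> determined by \<open>\<mu>\<^sub>G\<close> and \<open>\<mu>\<^sub>H\<close> through
  \<open>\<integral>\<^sub>G F(g) dg = \<integral>\<^bsub>H\G\<^esub> \<integral>\<^sub>H F(hg) dh dg\<close>. For unimodular \<open>H\<close> the inner integral does not depend on the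
  chosen representative of the coset.
\<close>

definition quotient_measure ::
    "('a::{semiring_1,topological_space}^'n^'n) set \<Rightarrow> ('a^'n^'n) set \<Rightarrow>
     ('a^'n^'n) measure \<Rightarrow> ('a^'n^'n) measure \<Rightarrow> ('a^'n^'n) set measure \<Rightarrow> bool" where
  "quotient_measure H G \<mu>H \<mu>G \<nu> \<longleftrightarrow>
     sets \<nu> = sets (quotient_borel H G) \<and>
     (\<forall>F \<in> borel_measurable \<mu>G.
        (\<integral>\<^sup>+ g. F g \<partial>\<mu>G) = (\<integral>\<^sup>+ S. (\<integral>\<^sup>+ h. F (h ** coset_rep S) \<partial>\<mu>H) \<partial>\<nu>))"

section \<open>Weighted orbital integrals\<close>

definition harish_chandra :: "'p::prime_card padic^2^2 \<Rightarrow> real \<times> real" where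
  "harish_chandra g =
     (THE h. \<exists>t x y k. x \<noteq> 0 \<and> y \<noteq> 0 \<and> k \<in> GL2_integral \<and>
        g = upper_unipotent t ** diag2 x y ** k \<and> h = (ln (padic_norm x), ln (padic_norm y)))"

definition root_alpha :: "real \<times> real \<Rightarrow> real" where
  "root_alpha h = fst h - snd h"

definition wOrb_integrand ::
    "('p::prime_card padic^2^2 \<Rightarrow> real) \<Rightarrow> 'p padic^2^2 \<Rightarrow> 'p padic^2^2 \<Rightarrow> real" where
  "wOrb_integrand f \<gamma> g =
     f (matrix_inv g ** \<gamma> ** g) * root_alpha (harish_chandra (weyl ** g) + harish_chandra g)"

text \<open>
  Here \<open>\<nu>\<close> is the measure on \<open>A\G\<close>; for \<open>\<gamma> \<in> A\<close> the integrand is left \<open>A\<close>-invariant, so it may be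
  evaluated at any representative.
\<close>

definition wOrb ::
    "('p::prime_card padic^2^2) set measure \<Rightarrow> ('p padic^2^2 \<Rightarrow> real) \<Rightarrow> 'p padic^2^2 \<Rightarrow> real" where
  "wOrb \<nu> f \<gamma> = (\<integral>S. wOrb_integrand f \<gamma> (coset_rep S) \<partial>\<nu>)"

end

theory Submission
  imports Defs
begin

text \<open>
  Writing \<open>r\<^sub>1, r\<^sub>2\<close> for the rows of \<open>g\<close> with their maximum norms, the ratio
  \<open>\<rho>(g) = |r\<^sub>1| |r\<^sub>2| / |det g|\<close> is left \<open>A\<close>-invariant and right \<open>K\<close>-invariant with values in the powers
  of \<open>p\<close>. The weight is \<open>-2 ln \<rho>(g)\<close>, and \<open>g\<^sup>-\<^sup>1 \<gamma> g\<close> lies in the support of the test function iff \<open>a, b\<close>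
  satisfy the stated conditions and \<open>\<rho>(g) \<le> 1 / |a - b| = p^k\<close>. Every \<open>A\<close>-orbit with
  \<open>\<rho> \<le> p^j\<close> meets \<open>n(t) K\<close> for some \<open>|t| \<le> p^j\<close>; as \<open>t\<close> matters only modulo \<open>\<int>\<^sub>p\<close>, the set
  \<open>{\<rho> \<le> p^j}\<close> of \<open>A\G\<close> has volume \<open>p^j\<close>. Since \<open>ln \<rho> = ln p \<cdot> #{j. p^j < \<rho>}\<close>, the integral is
  \<open>-2 ln p \<Sum>\<^bsub>j<k\<^esub> (p^k - p^j)\<close>.
\<close>

section \<open>The p-adic absolute value\<close>

lemma padic_class_cases:
  fixes x :: "'p::prime_card padic"
  obtains X where "padic_cauchy CARD('p) X" "x = padic_class X"
proof -
  have "padic_rel CARD('p) (padic_rep x) (padic_rep x)" "padic_class (padic_rep x) = x"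
    using Quotient_rep_reflp[OF Quotient_padic] Quotient_abs_rep[OF Quotient_padic] by blast+
  then show ?thesis using that by (metis padic_rel_refl_iff)
qed

lemma tendsto_padic_norm_class:
  assumes "padic_cauchy CARD('p::prime_card) X"
  shows "(\<lambda>n. padic_abs CARD('p) (X n)) \<longlonglongrightarrow> padic_norm (padic_class X :: 'p padic)"
proof -
  have "padic_norm (padic_class X :: 'p padic) = lim (\<lambda>n. padic_abs CARD('p) (X n))"
    using assms by (simp add: padic_norm.abs_eq padic_rel_refl_iff)
  then show ?thesis
    using padic_cauchy_abs_convergent[OF prime_CARD assms] by (simp add: convergent_LIMSEQ_iff)
qed

text \<open>Positivity and definiteness of the norm are already contained in the metric space
  instance; reading the norm as a distance to 0 recovers them.\<close>

lemma padic_norm_eq_dist: "padic_norm (x :: 'p::prime_card padic) = dist x 0"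
  by (simp add: dist_padic_def)

lemma padic_norm_nonneg [simp]: "padic_norm (x :: 'p::prime_card padic) \<ge> 0"
  by (simp add: padic_norm_eq_dist)

lemma padic_norm_eq_0_iff [simp]: "padic_norm (x :: 'p::prime_card padic) = 0 \<longleftrightarrow> x = 0"
  by (simp add: padic_norm_eq_dist)

lemma padic_norm_pos_iff [simp]: "padic_norm (x :: 'p::prime_card padic) > 0 \<longleftrightarrow> x \<noteq> 0"
  by (simp add: padic_norm_eq_dist)

lemma padic_norm_0 [simp]: "padic_norm (0 :: 'p::prime_card padic) = 0"
  by simp

lemma padic_norm_mult:
  "padic_norm (x * y :: 'p::prime_card padic) = padic_norm x * padic_norm y"
proof -
  obtain X where X: "padic_cauchy CARD('p) X" "x = padic_class X" by (rule padic_class_cases)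
  obtain Y where Y: "padic_cauchy CARD('p) Y" "y = padic_class Y" by (rule padic_class_cases)
  have "x * y = padic_class (\<lambda>n. X n * Y n)"
    using X Y by (simp add: times_padic.abs_eq padic_rel_refl_iff)
  moreover have "(\<lambda>n. padic_abs CARD('p) (X n * Y n)) \<longlonglongrightarrow> padic_norm x * padic_norm y"
    using tendsto_mult[OF tendsto_padic_norm_class[OF X(1)] tendsto_padic_norm_class[OF Y(1)]] X(2) Y(2)
    by (simp add: padic_abs_mult[OF prime_CARD])
  ultimately show ?thesis
    using tendsto_padic_norm_class[OF padic_cauchy_mult[OF prime_CARD X(1) Y(1)]] LIMSEQ_unique
    by metis
qed

lemma padic_norm_ultra:
  "padic_norm (x + y :: 'p::prime_card padic) \<le> max (padic_norm x) (padic_norm y)"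
proof -
  obtain X where X: "padic_cauchy CARD('p) X" "x = padic_class X" by (rule padic_class_cases)
  obtain Y where Y: "padic_cauchy CARD('p) Y" "y = padic_class Y" by (rule padic_class_cases)
  have "x + y = padic_class (\<lambda>n. X n + Y n)"
    using X Y by (simp add: plus_padic.abs_eq padic_rel_refl_iff)
  then show ?thesis
    using LIMSEQ_le[OF tendsto_padic_norm_class[OF padic_cauchy_add[OF prime_CARD X(1) Y(1)]]
        tendsto_max[OF tendsto_padic_norm_class[OF X(1)] tendsto_padic_norm_class[OF Y(1)]]]
      padic_abs_ultra[OF prime_CARD] X(2) Y(2) by metis
qed

lemma padic_norm_1 [simp]: "padic_norm (1 :: 'p::prime_card padic) = 1"
  using padic_norm_mult[of 1 "1 :: 'p padic"] by simp

lemma padic_norm_minus [simp]: "padic_norm (- x :: 'p::prime_card padic) = padic_norm x"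
proof -
  have "padic_norm (-1 :: 'p padic) * padic_norm (-1 :: 'p padic) = 1"
    using padic_norm_mult[of "-1" "-1 :: 'p padic"] by simp
  then have "padic_norm (-1 :: 'p padic) = 1"
    by (metis abs_of_nonneg padic_norm_nonneg real_sqrt_abs2 real_sqrt_one)
  then show ?thesis using padic_norm_mult[of "-1" x] by simp
qed

lemma padic_norm_ultra_diff:
  "padic_norm (x - y :: 'p::prime_card padic) \<le> max (padic_norm x) (padic_norm y)"
  using padic_norm_ultra[of x "- y"] by simp

lemma padic_norm_inverse:
  "padic_norm (inverse x :: 'p::prime_card padic) = inverse (padic_norm x)"
proof (cases "x = 0")
  case False
  then have "padic_norm x * padic_norm (inverse x) = 1"
    by (simp flip: padic_norm_mult)
  then show ?thesis by (metis inverse_unique)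
qed simp

lemma padic_norm_divide:
  "padic_norm (x / y :: 'p::prime_card padic) = padic_norm x / padic_norm y"
  by (simp add: divide_inverse padic_norm_mult padic_norm_inverse)

lemma padic_norm_power:
  "padic_norm (x ^ n :: 'p::prime_card padic) = padic_norm x ^ n"
  by (induction n) (simp_all add: padic_norm_mult)

lemma CARD_gt_1: "real CARD('p::prime_card) > 1"
  using prime_gt_1_nat[OF prime_CARD[where 'a='p]] by simp

text \<open>The value group is discrete: by the ultrametric inequality the absolute values along a
  Cauchy sequence that is not null become constant, so the norm is that of a single
  rational.\<close>

lemma padic_norm_eq_powi:
  fixes x :: "'p::prime_card padic"
  assumes "x \<noteq> 0"
  obtains v where "padic_norm x = real CARD('p) powi (- v)"
proof -
  let ?p = "CARD('p)"
  note P = prime_CARD[where 'a='p]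
  obtain X where X: "padic_cauchy ?p X" "x = padic_class X" by (rule padic_class_cases)
  have L: "(\<lambda>n. padic_abs ?p (X n)) \<longlonglongrightarrow> padic_norm x"
    using tendsto_padic_norm_class[OF X(1)] X(2) by simp
  have "\<not> padic_null ?p X"
    using L assms LIMSEQ_unique unfolding padic_null_def by fastforce
  then obtain c M where c: "c > 0" "\<And>n. n \<ge> M \<Longrightarrow> padic_abs ?p (X n) \<ge> c"
    using padic_cauchy_not_null[OF P X(1)] by metis
  obtain N where N: "\<And>m n. m \<ge> N \<Longrightarrow> n \<ge> N \<Longrightarrow> padic_abs ?p (X m - X n) < c"
    using padic_cauchyD[OF P X(1) c(1)] by blast
  define K where "K = max M N"
  \<comment> \<open>The tail is bounded below by \<open>c\<close> while its differences stay below
    \<open>c\<close>, so \<open>X m - X n\<close> cannot dominate; by symmetry the absolute values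
    agree.\<close>
  have le: "padic_abs ?p (X m) \<le> padic_abs ?p (X n)" if "m \<ge> K" "n \<ge> K" for m n
  proof -
    have "padic_abs ?p (X m - X n) < padic_abs ?p (X m)"
      using N[of m n] c(2)[of m] that by (simp add: K_def)
    then show ?thesis using padic_abs_ultra[OF P, of "X m - X n" "X n"] by simp
  qed
  then have "\<forall>\<^sub>F n in sequentially. padic_abs ?p (X n) = padic_abs ?p (X K)"
    unfolding eventually_sequentially by (metis order_antisym order_refl)
  then have "(\<lambda>n. padic_abs ?p (X n)) \<longlonglongrightarrow> padic_abs ?p (X K)"
    by (rule tendsto_eventually)
  then have eq: "padic_norm x = padic_abs ?p (X K)" using L LIMSEQ_unique by blast
  moreover have "X K \<noteq> 0" using eq assms P by auto
  ultimately show ?thesis using that by (simp add: padic_abs_def)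
qed

lemma padic_val_eqI:
  fixes x :: "'p::prime_card padic"
  assumes "padic_norm x = real CARD('p) powi (- v)"
  shows "padic_val x = v"
  unfolding padic_val_def
proof (rule the_equality)
  fix w assume "padic_norm x = real CARD('p) powi (- w)"
  then have "real CARD('p) powi (- w) = real CARD('p) powi (- v)" using assms by simp
  then have "- w = - v"
    using CARD_gt_1[where 'p='p] power_int_strict_increasing[of _ _ "real CARD('p)"]
    by (metis less_irrefl linorder_neqE)
  then show "w = v" by simp
qed (rule assms)

section \<open>Natural numbers inside the p-adic integers, and their density\<close>

lemma padic_class_of_nat: "of_nat i = (padic_class (\<lambda>n. of_nat i) :: 'p::prime_card padic)"
proof (induction i)
  case 0
  then show ?case by (simp add: zero_padic.abs_eq)
next
  case (Suc i)
  have "(padic_class (\<lambda>n. 1) + padic_class (\<lambda>n. of_nat i) :: 'p padic) = padic_class (\<lambda>n. 1 + of_nat i)"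
    by (subst plus_padic.abs_eq) (simp_all add: padic_rel_refl_iff padic_cauchy_const[OF prime_CARD])
  then show ?case using Suc by (simp add: one_padic.abs_eq)
qed

lemma padic_norm_of_nat: "padic_norm (of_nat i :: 'p::prime_card padic) = padic_abs CARD('p) (of_nat i)"
  using tendsto_padic_norm_class[where 'p='p and X="\<lambda>n. of_nat i"]
    padic_cauchy_const[OF prime_CARD[where 'a='p]]
  by (simp add: padic_class_of_nat LIMSEQ_const_iff)

text \<open>Translates size into divisibility. This later separates residues modulo p^j and, at
  \<open>j = 0\<close>, shows that natural numbers are integral.\<close>

lemma padic_norm_of_nat_le_iff:
  assumes "i \<noteq> 0"
  shows "padic_norm (of_nat i :: 'p::prime_card padic) \<le> inverse (real CARD('p) ^ j) \<longleftrightarrow> CARD('p) ^ j dvd i"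
proof -
  let ?p = "CARD('p)"
  note P = prime_CARD[where 'a='p]
  have "padic_norm (of_nat i :: 'p padic) = real ?p powi (- int (multiplicity (int ?p) (int i)))"
    using padic_abs_quotient[OF P, of "int i" 1] assms
    by (simp add: padic_norm_of_nat)
  moreover have "inverse (real ?p ^ j) = real ?p powi (- int j)"
    by (simp add: power_int_minus)
  moreover have "real ?p powi (- int (multiplicity (int ?p) (int i))) \<le> real ?p powi (- int j)
      \<longleftrightarrow> j \<le> multiplicity (int ?p) (int i)"
    using power_int_increasing[of "- int (multiplicity (int ?p) (int i))" "- int j" "real ?p"]
      power_int_strict_increasing[of "- int j" "- int (multiplicity (int ?p) (int i))" "real ?p"] CARD_gt_1[where 'p='p]
    by linarith
  moreover have "j \<le> multiplicity (int ?p) (int i) \<longleftrightarrow> ?p ^ j dvd i"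
  proof -
    have "j \<le> multiplicity (int ?p) (int i) \<longleftrightarrow> int ?p ^ j dvd int i"
      using prime_int_p[OF P] assms
      by (metis multiplicity_dvd' multiplicity_geI not_prime_unit of_nat_eq_0_iff)
    then show ?thesis by (metis of_nat_dvd_iff of_nat_power)
  qed
  ultimately show ?thesis by simp
qed

lemma padic_norm_CARD: "padic_norm (of_nat CARD('p) :: 'p::prime_card padic) = inverse (real CARD('p))"
proof -
  note P = prime_CARD[where 'a='p]
  have "padic_abs CARD('p) (of_nat CARD('p)) = real CARD('p) powi (-1)"
    using padic_abs_quotient[OF P, of "int CARD('p)" 1] P by (simp add: prime_gt_0_nat)
  then show ?thesis by (simp add: padic_norm_of_nat power_int_minus)
qed

text \<open>The residues 0, ..., p^j - 1 represent the p-adic integers modulo p^j. A late term of a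
  Cauchy sequence for \<open>x\<close> is a rational with denominator prime to p, and such a
  denominator can be inverted modulo p^j.\<close>

lemma padic_integer_approx:
  fixes x :: "'p::prime_card padic"
  assumes "padic_norm x \<le> 1"
  obtains i where "i < CARD('p) ^ j" "padic_norm (x - of_nat i) \<le> inverse (real CARD('p) ^ j)"
proof -
  let ?p = "CARD('p)"
  note P = prime_CARD[where 'a='p]
  define e where "e = inverse (real ?p ^ j)"
  have e: "0 < e" "e \<le> 1"
    using CARD_gt_1[where 'p='p] by (auto simp: e_def inverse_le_1_iff)
  obtain X where X: "padic_cauchy ?p X" "x = padic_class X" by (rule padic_class_cases)
  \<comment> \<open>Convergence only gives a bound below p, but no absolute value lies strictly
    between 1 and p, so the bound improves to 1.\<close>
  have ev1: "\<forall>\<^sub>F n in sequentially. padic_abs ?p (X n) \<le> 1"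
  proof -
    have "\<forall>\<^sub>F n in sequentially. padic_abs ?p (X n) < real ?p"
      using order_tendstoD(2)[OF tendsto_padic_norm_class[OF X(1)], of "real ?p"] X(2) assms
        CARD_gt_1[where 'p='p] by simp
    moreover have "padic_abs ?p r \<le> 1" if "padic_abs ?p r < real ?p" for r
    proof (rule ccontr)
      assume r: "\<not> padic_abs ?p r \<le> 1"
      then have "r \<noteq> 0" using P by auto
      then have a: "padic_abs ?p r = real ?p powi (- padic_val_rat ?p r)"
        by (simp add: padic_abs_def)
      show False
      proof (cases "- padic_val_rat ?p r \<ge> 1")
        case True
        then have "real ?p powi 1 \<le> padic_abs ?p r"
          unfolding a using CARD_gt_1[where 'p='p] by (intro power_int_increasing) auto
        then show False using that by simp
      next
        case False
        then have "padic_abs ?p r \<le> real ?p powi 0"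
          unfolding a using CARD_gt_1[where 'p='p] by (intro power_int_increasing) auto
        then show False using r by simp
      qed
    qed
    ultimately show ?thesis by (auto elim: eventually_mono)
  qed
  obtain N where N: "\<And>m n. m \<ge> N \<Longrightarrow> n \<ge> N \<Longrightarrow> padic_abs ?p (X m - X n) < e"
    using padic_cauchyD[OF P X(1) e(1)] by blast
  obtain M where M: "\<And>n. n \<ge> M \<Longrightarrow> padic_abs ?p (X n) \<le> 1"
    using ev1 by (auto simp: eventually_sequentially)
  define K where "K = max M N"
  have XK: "padic_abs ?p (X K) \<le> 1" using M by (simp add: K_def)
  obtain i where i: "i < ?p ^ j" "padic_abs ?p (X K - of_nat i) \<le> e"
  proof -
    obtain n d where nd: "quotient_of (X K) = (n, d)" by (cases "quotient_of (X K)")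
    have r: "X K = of_int n / of_int d" and d: "d > 0" and cop: "coprime n d"
      using quotient_of_div[OF nd] quotient_of_denom_pos[OF nd] quotient_of_coprime[OF nd] by auto
    \<comment> \<open>In lowest terms, a denominator divisible by p would force an absolute value of
      at least p.\<close>
    have pd: "\<not> int ?p dvd d"
    proof
      assume pd: "int ?p dvd d"
      then have "\<not> int ?p dvd n"
        using cop prime_int_p[OF P] by (metis coprime_common_divisor not_prime_unit)
      then have m: "multiplicity (int ?p) n = 0" by (rule not_dvd_imp_multiplicity_0)
      have "multiplicity (int ?p) d \<ge> 1"
        using pd d prime_int_p[OF P] by (intro multiplicity_geI) (auto simp: not_prime_unit)
      then have "real ?p powi 1 \<le> real ?p powi int (multiplicity (int ?p) d)"
        using CARD_gt_1[where 'p='p] by (intro power_int_increasing) auto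
      moreover have "n \<noteq> 0" using \<open>\<not> int ?p dvd n\<close> by auto
      ultimately have "padic_abs ?p (X K) \<ge> real ?p powi 1"
        unfolding r using d m by (simp add: padic_abs_quotient[OF P])
      then show False using XK CARD_gt_1[where 'p='p] by simp
    qed
    have "coprime d (int ?p ^ j)"
      using pd prime_int_p[OF P] by (metis coprime_commute coprime_power_left_iff prime_imp_coprime)
    then obtain u v where uv: "u * d + v * int ?p ^ j = 1"
      by (metis bezout_int coprime_iff_gcd_eq_1)
    \<comment> \<open>Since \<open>u\<close> inverts \<open>d\<close> modulo p^j, the residue
      \<open>w\<close> satisfies \<open>d * w\<close> congruent to \<open>n\<close>.\<close>
    define w where "w = (n * u) mod int ?p ^ j"
    have pj: "int ?p ^ j > 0" using P by (simp add: prime_gt_0_nat)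
    have w: "0 \<le> w" "w < int ?p ^ j" using pj by (simp_all add: w_def)
    have dv: "int ?p ^ j dvd n - d * w"
    proof -
      have "int ?p ^ j dvd n * u - w" unfolding w_def by (simp add: minus_mod_eq_mult_div)
      then have "int ?p ^ j dvd d * (n * u - w) + n * (v * int ?p ^ j)" by simp
      also have "d * (n * u - w) + n * (v * int ?p ^ j) = n * (u * d + v * int ?p ^ j) - d * w"
        by (simp add: algebra_simps)
      finally show ?thesis using uv by simp
    qed
    \<comment> \<open>The valuation formula for quotients needs a nonzero numerator, so exact
      equality is treated separately.\<close>
    have "padic_abs ?p (X K - of_nat (nat w)) \<le> e"
    proof (cases "n - d * w = 0")
      case True
      then have "X K = of_int w" using r d by simp
      then show ?thesis using w e P by simp
    next
      case False
      have "X K - of_nat (nat w) = of_int (n - d * w) / of_int d"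
        using r d w by (simp add: field_simps)
      moreover have "multiplicity (int ?p) d = 0" using pd by (rule not_dvd_imp_multiplicity_0)
      moreover have "j \<le> multiplicity (int ?p) (n - d * w)"
        using dv False prime_int_p[OF P] by (intro multiplicity_geI) (auto simp: not_prime_unit)
      moreover have "e = real ?p powi (- int j)" by (simp add: e_def power_int_minus)
      ultimately show ?thesis
        using d False CARD_gt_1[where 'p='p] padic_abs_quotient[OF P False, of d]
        by (auto intro!: power_int_increasing)
    qed
    moreover have "nat w < ?p ^ j" using w by (metis nat_less_iff of_nat_power)
    ultimately show ?thesis using that by blast
  qed
  have eq: "x - of_nat i = padic_class (\<lambda>n. X n + - of_nat i)"
    using X padic_cauchy_const[OF P]
    by (simp add: padic_class_of_nat minus_padic_def plus_padic.abs_eq uminus_padic.abs_eq padic_rel_refl_iff)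
  have "padic_norm (x - of_nat i) \<le> e"
  proof (unfold eq, rule LIMSEQ_le_const2)
    show "(\<lambda>n. padic_abs ?p (X n + - of_nat i)) \<longlonglongrightarrow> padic_norm (padic_class (\<lambda>n. X n + - of_nat i) :: 'p padic)"
      by (intro tendsto_padic_norm_class padic_cauchy_add[OF P] X padic_cauchy_const[OF P])
    have "padic_abs ?p (X n + - of_nat i) \<le> e" if "n \<ge> K" for n
      using padic_abs_ultra[OF P, of "X n - X K" "X K - of_nat i"] N[of n K] i(2) that
      by (simp add: K_def)
    then show "\<exists>N. \<forall>n\<ge>N. padic_abs ?p (X n + - of_nat i) \<le> e" by blast
  qed
  then show ?thesis using that i(1) unfolding e_def by blast
qed

section \<open>Continuity of addition and multiplication on the p-adic field\<close>

instance padic :: (prime_card) topological_ab_group_add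
proof
  fix a b :: "'a padic"
  show "((\<lambda>x. fst x + snd x) \<longlongrightarrow> a + b) (nhds a \<times>\<^sub>F nhds b)"
  proof (rule tendstoI)
    fix e :: real assume "e > 0"
    then have "\<forall>\<^sub>F x in nhds a \<times>\<^sub>F nhds b. dist (fst x) a < e \<and> dist (snd x) b < e"
      by (intro eventually_prodI) (auto simp: eventually_nhds_metric)
    then show "\<forall>\<^sub>F x in nhds a \<times>\<^sub>F nhds b. dist (fst x + snd x) (a + b) < e"
    proof (rule eventually_mono)
      fix x assume "dist (fst x) a < e \<and> dist (snd x) b < e"
      then show "dist (fst x + snd x) (a + b) < e"
        using padic_norm_ultra[of "fst x - a" "snd x - b"]
        by (auto simp: dist_padic_def add_diff_add)
    qed
  qed
  show "(uminus \<longlongrightarrow> - a) (nhds a)"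
  proof (rule tendstoI)
    fix e :: real assume "e > 0"
    then show "\<forall>\<^sub>F x in nhds a. dist (- x) (- a) < e"
      using padic_norm_minus[of "_ - a"]
      by (auto simp: eventually_nhds_metric dist_padic_def)
  qed
qed

instance padic :: (prime_card) topological_semigroup_mult
proof
  fix a b :: "'a padic"
  show "((\<lambda>x. fst x * snd x) \<longlongrightarrow> a * b) (nhds a \<times>\<^sub>F nhds b)"
  proof (rule tendstoI)
    fix e :: real assume e: "e > 0"
    define C where "C = padic_norm a + padic_norm b + 1"
    have C: "C > 0" "padic_norm a \<le> C" "padic_norm b + 1 \<le> C"
      by (simp_all add: C_def add_nonneg_pos)
    \<comment> \<open>With \<open>d \<le> 1\<close> a nearby \<open>y\<close> has norm at most
      \<open>C\<close>, and \<open>d * C \<le> e\<close> makes both parts of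
      \<open>(x - a) * y + a * (y - b)\<close> smaller than \<open>e\<close>.\<close>
    define d where "d = min 1 (e / C)"
    have d: "d > 0" "d \<le> 1" "d * C \<le> e" using e C(1) by (auto simp: d_def min_def field_simps)
    from d have "\<forall>\<^sub>F x in nhds a \<times>\<^sub>F nhds b. dist (fst x) a < d \<and> dist (snd x) b < d"
      by (intro eventually_prodI) (auto simp: eventually_nhds_metric)
    then show "\<forall>\<^sub>F x in nhds a \<times>\<^sub>F nhds b. dist (fst x * snd x) (a * b) < e"
    proof (rule eventually_mono)
      fix z assume z: "dist (fst z) a < d \<and> dist (snd z) b < d"
      define x y where "x = fst z" and "y = snd z"
      have xy: "padic_norm (x - a) < d" "padic_norm (y - b) < d"
        using z by (simp_all add: x_def y_def dist_padic_def)
      have "padic_norm y \<le> padic_norm b + 1"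
        using padic_norm_ultra[of "y - b" b] xy(2) d(2) padic_norm_nonneg[of b]
        by (simp del: padic_norm_nonneg)
      then have y: "padic_norm y \<le> C" using C by simp
      have 1: "padic_norm ((x - a) * y) < e"
        using mult_left_mono[OF y padic_norm_nonneg[of "x - a"]] mult_strict_right_mono[OF xy(1) C(1)] d(3)
        by (simp add: padic_norm_mult)
      have 2: "padic_norm (a * (y - b)) < e"
        using mult_right_mono[OF C(2) padic_norm_nonneg[of "y - b"]]
          mult_strict_left_mono[OF xy(2) C(1)] d(3)
        by (simp add: padic_norm_mult mult.commute)
      have "x * y - a * b = (x - a) * y + a * (y - b)" by (simp add: algebra_simps)
      then show "dist (fst z * snd z) (a * b) < e"
        using padic_norm_ultra[of "(x - a) * y" "a * (y - b)"] 1 2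
        by (simp add: dist_padic_def x_def y_def)
    qed
  qed
qed

lemma continuous_on_padic_norm [continuous_intros]:
  fixes f :: "'a::topological_space \<Rightarrow> 'p::prime_card padic"
  shows "continuous_on S f \<Longrightarrow> continuous_on S (\<lambda>x. padic_norm (f x))"
  unfolding padic_norm_eq_dist by (intro continuous_intros)

section \<open>Rows of two-by-two matrices\<close>

text \<open>Being a maximum, this turns integrality of a row into one inequality; it is also the
  norm preserved by right multiplication with \<open>GL2_integral\<close>.\<close>

definition row_norm :: "'p::prime_card padic ^ 2 \<Rightarrow> real" where
  "row_norm r = max (padic_norm (r $ 1)) (padic_norm (r $ 2))"

lemma row_norm_le_iff: "row_norm r \<le> c \<longleftrightarrow> (\<forall>i. padic_norm (r $ i) \<le> c)"
  by (simp add: row_norm_def forall_2)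

lemma row_norm_nonneg: "row_norm r \<ge> 0"
  by (simp add: row_norm_def le_max_iff_disj)

lemma row_norm_scale: "row_norm (c *s r) = padic_norm c * row_norm r"
  by (simp add: row_norm_def padic_norm_mult max_mult_distrib_left)

lemma row_norm_add: "row_norm (r + s) \<le> max (row_norm r) (row_norm s)"
  using padic_norm_ultra[of "r $ 1" "s $ 1"] padic_norm_ultra[of "r $ 2" "s $ 2"]
  unfolding row_norm_def by (simp add: le_max_iff_disj) argo

lemma row_norm_diff: "row_norm (r - s) \<le> max (row_norm r) (row_norm s)"
  using padic_norm_ultra_diff[of "r $ 1" "s $ 1"] padic_norm_ultra_diff[of "r $ 2" "s $ 2"]
  unfolding row_norm_def by (simp add: le_max_iff_disj) argo

text \<open>Ultrametric Hadamard inequality: both terms of the determinant take one entry from each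
  row. It yields \<rho> \<ge> 1.\<close>

lemma padic_norm_det_le: "padic_norm (det g) \<le> row_norm (g $ 1) * row_norm (g $ 2)"
proof -
  have "padic_norm (g $ 1 $ i * g $ 2 $ j) \<le> row_norm (g $ 1) * row_norm (g $ 2)" for i j
    unfolding padic_norm_mult
    using row_norm_le_iff[of "g $ 1" "row_norm (g $ 1)"] row_norm_le_iff[of "g $ 2" "row_norm (g $ 2)"]
    by (intro mult_mono) (auto simp: row_norm_nonneg)
  then show ?thesis
    unfolding det_2 using padic_norm_ultra_diff[of "g $ 1 $ 1 * g $ 2 $ 2" "g $ 1 $ 2 * g $ 2 $ 1"]
    by (meson max.boundedI order_trans)
qed

text \<open>Each maximum is attained, which makes \<rho> the norm of a single field element and
  makes entrywise bounds sharp.\<close>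

lemma row_norm_product:
  obtains i j where "row_norm r * row_norm s = padic_norm (r $ i * s $ j)"
  unfolding row_norm_def padic_norm_mult by (metis max_def)

lemma upper_unipotent_mult_rows:
  fixes g :: "'a::comm_ring_1 ^ 2 ^ 2"
  shows "(upper_unipotent t ** g) $ 1 = g $ 1 + t *s g $ 2" "(upper_unipotent t ** g) $ 2 = g $ 2"
  by (simp_all add: upper_unipotent_def matrix_matrix_mult_def vec_eq_iff sum_2)

lemma diag2_mult_rows:
  fixes g :: "'a::comm_ring_1 ^ 2 ^ 2"
  shows "(diag2 x y ** g) $ 1 = x *s g $ 1" "(diag2 x y ** g) $ 2 = y *s g $ 2"
  by (simp_all add: diag2_def matrix_matrix_mult_def vec_eq_iff sum_2)

lemma weyl_mult_rows:
  fixes g :: "'a::comm_ring_1 ^ 2 ^ 2"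
  shows "(weyl ** g) $ 1 = g $ 2" "(weyl ** g) $ 2 = g $ 1"
  by (simp_all add: weyl_def matrix_matrix_mult_def vec_eq_iff sum_2)

lemma det_upper_unipotent: "det (upper_unipotent (t :: 'a::comm_ring_1)) = 1"
  by (simp add: det_2 upper_unipotent_def)

lemma det_diag2: "det (diag2 x (y :: 'a::comm_ring_1)) = x * y"
  by (simp add: det_2 diag2_def)

lemma det_weyl: "det (weyl :: 'a::comm_ring_1^2^2) = - 1"
  by (simp add: det_2 weyl_def)

lemma GL2_iff: "g \<in> GL2 \<longleftrightarrow> det g \<noteq> 0"
  by (simp add: GL2_def invertible_det_nz)

section \<open>Integral matrices, Iwasawa decomposition and the Harish-Chandra map\<close>

lemma GL2_integral_iff:
  "k \<in> GL2_integral \<longleftrightarrow> row_norm (k $ 1) \<le> 1 \<and> row_norm (k $ 2) \<le> 1 \<and> padic_norm (det k) = 1"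
  by (auto simp: GL2_integral_def padic_integers_def row_norm_le_iff forall_2)

text \<open>Both row norms are at most 1, and by the Hadamard inequality their product is at least
  1.\<close>

lemma GL2_integral_row_norm:
  assumes "k \<in> GL2_integral"
  shows "row_norm (k $ 1) = 1" "row_norm (k $ 2) = 1"
proof -
  have k: "row_norm (k $ 1) \<le> 1" "row_norm (k $ 2) \<le> 1" "1 \<le> row_norm (k $ 1) * row_norm (k $ 2)"
    using assms padic_norm_det_le[of k] by (auto simp: GL2_integral_iff)
  show "row_norm (k $ 1) = 1"
    using k mult_right_le_one_le[of "row_norm (k $ 1)" "row_norm (k $ 2)"]
    by (simp add: row_norm_nonneg)
  show "row_norm (k $ 2) = 1"
    using k mult_left_le_one_le[of "row_norm (k $ 2)" "row_norm (k $ 1)"]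
    by (simp add: row_norm_nonneg)
qed

text \<open>The bottom row of \<open>g\<close> is divided by its larger entry, which leaves an
  integral row containing a 1; a standard basis vector completes it to an integral
  \<open>k\<close>.\<close>

lemma iwasawa_decomposition:
  fixes g :: "'p::prime_card padic^2^2"
  assumes "det g \<noteq> 0"
  obtains t x y k where "x \<noteq> 0" "y \<noteq> 0" "k \<in> GL2_integral"
    "g = upper_unipotent t ** diag2 x y ** k"
proof (cases "padic_norm (g $ 2 $ 1) \<le> padic_norm (g $ 2 $ 2)")
  case True
  let ?d = "g $ 2 $ 2"
  have d: "?d \<noteq> 0"
  proof
    assume "?d = 0"
    moreover from this have "g $ 2 $ 1 = 0"
      using True padic_norm_eq_0_iff[of "g $ 2 $ 1"] padic_norm_nonneg[of "g $ 2 $ 1"]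
      by (simp del: padic_norm_nonneg padic_norm_eq_0_iff)
    ultimately show False using assms by (simp add: det_2)
  qed
  define k :: "'p padic^2^2" where "k = vector [vector [1, 0], vector [g $ 2 $ 1 / ?d, 1]]"
  have "k \<in> GL2_integral"
    using True d by (simp add: k_def GL2_integral_iff row_norm_def det_2 padic_norm_divide)
  moreover have "g = upper_unipotent (g $ 1 $ 2 / ?d) ** diag2 (det g / ?d) ?d ** k"
    using d by (simp add: vec_eq_iff forall_2 k_def upper_unipotent_def diag2_def
        matrix_matrix_mult_def sum_2 det_2 field_simps)
  ultimately show ?thesis using that[of "det g / ?d" ?d] d assms by simp
next
  case False
  let ?c = "g $ 2 $ 1"
  have c: "?c \<noteq> 0" using False by auto
  \<comment> \<open>This \<open>k\<close> has determinant -1, whence the sign in the torus entry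
    \<open>- det g / ?c\<close>.\<close>
  define k :: "'p padic^2^2" where "k = vector [vector [0, 1], vector [1, g $ 2 $ 2 / ?c]]"
  have "k \<in> GL2_integral"
    using False c by (simp add: k_def GL2_integral_iff row_norm_def det_2 padic_norm_divide)
  moreover have "g = upper_unipotent (g $ 1 $ 1 / ?c) ** diag2 (- det g / ?c) ?c ** k"
    using c by (simp add: vec_eq_iff forall_2 k_def upper_unipotent_def diag2_def
        matrix_matrix_mult_def sum_2 det_2 field_simps)
  ultimately show ?thesis using that[of "- det g / ?c" ?c] c assms by simp
qed

text \<open>The decomposition is not unique, but the norms of \<open>x\<close> and \<open>y\<close>
  depend on \<open>g\<close> alone, so the \<open>THE\<close> in \<open>harish_chandra\<close> is
  meaningful. The bottom row of \<open>g\<close> is \<open>y\<close> times a row of norm 1.\<close>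

lemma iwasawa_norms:
  assumes "k \<in> GL2_integral" "g = upper_unipotent t ** diag2 x y ** k"
  shows "padic_norm y = row_norm (g $ 2)" "padic_norm x * padic_norm y = padic_norm (det g)"
  using assms GL2_integral_row_norm[OF assms(1)]
  by (simp_all add: matrix_mul_assoc[symmetric] upper_unipotent_mult_rows diag2_mult_rows
      row_norm_scale det_mul det_upper_unipotent det_diag2 padic_norm_mult GL2_integral_iff)

lemma row_norm_pos:
  assumes "det g \<noteq> 0"
  shows "row_norm (g $ 1) > 0" "row_norm (g $ 2) > 0"
proof -
  have "0 < padic_norm (det g)" using assms by simp
  also note padic_norm_det_le[of g]
  finally show "row_norm (g $ 1) > 0" "row_norm (g $ 2) > 0"
    using row_norm_nonneg[of "g $ 1"] row_norm_nonneg[of "g $ 2"] by (auto simp: zero_less_mult_iff)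
qed

lemma harish_chandra_eq:
  assumes "det g \<noteq> 0"
  shows "harish_chandra g =
    (ln (padic_norm (det g)) - ln (row_norm (g $ 2)), ln (row_norm (g $ 2)))"
proof -
  have *: "(ln (padic_norm x), ln (padic_norm y)) =
      (ln (padic_norm (det g)) - ln (row_norm (g $ 2)), ln (row_norm (g $ 2)))"
    if "x \<noteq> 0" "y \<noteq> 0" "k \<in> GL2_integral" "g = upper_unipotent t ** diag2 x y ** k" for t x y k
  proof -
    have "ln (padic_norm (det g)) = ln (padic_norm x) + ln (padic_norm y)"
      using that(1,2) by (simp add: ln_mult flip: iwasawa_norms(2)[OF that(3,4)])
    then show ?thesis using iwasawa_norms(1)[OF that(3,4)] by simp
  qed
  obtain t x y k where "x \<noteq> 0" "y \<noteq> 0" "k \<in> GL2_integral" "g = upper_unipotent t ** diag2 x y ** k"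
    using iwasawa_decomposition[OF assms] by metis
  with * show ?thesis
    unfolding harish_chandra_def by (intro the_equality) metis+
qed

text \<open>This is the \<rho> of the overview. On \<open>upper_unipotent t\<close> it is the
  maximum of 1 and the norm of \<open>t\<close>.\<close>

definition row_ratio :: "'p::prime_card padic^2^2 \<Rightarrow> real" where
  "row_ratio g = row_norm (g $ 1) * row_norm (g $ 2) / padic_norm (det g)"

text \<open>A single term \<open>root_alpha (harish_chandra g)\<close> is the logarithm of the
  determinant norm minus twice that of the bottom row norm; \<open>weyl\<close> exchanges the rows,
  so the sum treats both rows alike.\<close>

lemma weight_eq_row_ratio:
  assumes "det g \<noteq> 0"
  shows "root_alpha (harish_chandra (weyl ** g) + harish_chandra g) = - 2 * ln (row_ratio g)"
proof -
  have "det (weyl ** g) \<noteq> 0" using assms by (simp add: det_mul det_weyl)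
  then show ?thesis
    using assms row_norm_pos[OF assms]
    by (simp add: harish_chandra_eq root_alpha_def weyl_mult_rows det_mul det_weyl row_ratio_def
        ln_mult ln_div)
qed

lemma row_ratio_diag2_mult:
  assumes "x \<noteq> 0" "y \<noteq> 0"
  shows "row_ratio (diag2 x y ** g) = row_ratio g"
  using assms
  by (simp add: row_ratio_def diag2_mult_rows row_norm_scale det_mul det_diag2 padic_norm_mult)

text \<open>The ratio is the norm of one field element, hence an integral power of p, and it is at
  least 1 by the Hadamard inequality.\<close>

lemma row_ratio_eq_power:
  fixes g :: "'p::prime_card padic^2^2"
  assumes "det g \<noteq> 0"
  obtains n :: nat where "row_ratio g = real CARD('p) ^ n"
proof -
  obtain i j where ij: "row_norm (g $ 1) * row_norm (g $ 2) = padic_norm (g $ 1 $ i * g $ 2 $ j)"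
    by (rule row_norm_product)
  define q where "q = g $ 1 $ i * g $ 2 $ j / det g"
  have q: "row_ratio g = padic_norm q"
    by (simp add: q_def row_ratio_def ij padic_norm_divide)
  have ge: "row_ratio g \<ge> 1"
    using padic_norm_det_le[of g] assms by (simp add: row_ratio_def)
  then have "q \<noteq> 0" using q by auto
  then obtain v where v: "padic_norm q = real CARD('p) powi (- v)" by (rule padic_norm_eq_powi)
  have "- v \<ge> 0"
  proof (rule ccontr)
    assume "\<not> - v \<ge> 0"
    then have "real CARD('p) powi (- v) < real CARD('p) powi 0"
      using CARD_gt_1[where 'p='p] by (intro power_int_strict_increasing) auto
    then show False using ge q v by simp
  qed
  then have "real CARD('p) powi (- v) = real CARD('p) ^ nat (- v)"
    by (simp add: power_int_def)
  then show ?thesis using that q v by simp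
qed

section \<open>The integrand\<close>

lemma matrix_inv_mult:
  fixes g :: "'a::field^'n^'n"
  assumes "det g \<noteq> 0"
  shows "g ** matrix_inv g = mat 1" "matrix_inv g ** g = mat 1"
proof -
  have "\<exists>h. g ** h = mat 1 \<and> h ** g = mat 1"
    using assms by (simp add: invertible_det_nz[symmetric] invertible_def)
  then have "g ** matrix_inv g = mat 1 \<and> matrix_inv g ** g = mat 1"
    unfolding matrix_inv_def by (rule someI_ex)
  then show "g ** matrix_inv g = mat 1" "matrix_inv g ** g = mat 1" by auto
qed

text \<open>The candidate \<open>Y\<close> is verified through
  \<open>g ** Y = diag2 a b ** g\<close>. This form isolates products of one entry from each row of
  \<open>g\<close>, whose largest norm gives \<open>row_ratio\<close>.\<close>

lemma conjugate_diag2: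
  fixes g :: "'a::field^2^2" and a b :: 'a
  assumes "det g \<noteq> 0"
  defines "X \<equiv> matrix_inv g ** diag2 a b ** g" and "D \<equiv> det g"
  shows "X $ 1 $ 1 = a + (a - b) * (g $ 1 $ 2 * g $ 2 $ 1 / D)"
    and "X $ 1 $ 2 = (a - b) * (g $ 1 $ 2 * g $ 2 $ 2 / D)"
    and "X $ 2 $ 1 = - ((a - b) * (g $ 1 $ 1 * g $ 2 $ 1 / D))"
    and "X $ 2 $ 2 = b - (a - b) * (g $ 1 $ 2 * g $ 2 $ 1 / D)"
proof -
  have inv: "matrix_inv g ** g = mat 1"
    using assms(1) by (rule matrix_inv_mult)
  define Y :: "'a^2^2" where "Y = vector [
     vector [a + (a - b) * (g $ 1 $ 2 * g $ 2 $ 1 / D), (a - b) * (g $ 1 $ 2 * g $ 2 $ 2 / D)],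
     vector [- ((a - b) * (g $ 1 $ 1 * g $ 2 $ 1 / D)), b - (a - b) * (g $ 1 $ 2 * g $ 2 $ 1 / D)]]"
  have D: "D \<noteq> 0" "D = g $ 1 $ 1 * g $ 2 $ 2 - g $ 1 $ 2 * g $ 2 $ 1"
    using assms(1) by (simp_all add: D_def det_2)
  \<comment> \<open>Multiplying by the determinant turns the comparison into polynomial
    identities.\<close>
  have "D * (g ** Y) $ i $ j = D * (diag2 a b ** g) $ i $ j" for i j
    using exhaust_2[of i] exhaust_2[of j] D(1)
    by (auto simp: matrix_matrix_mult_def sum_2 Y_def diag2_def distrib_left right_diff_distrib)
      (simp_all add: D(2) algebra_simps)
  then have "g ** Y = diag2 a b ** g" using D(1) by (simp add: vec_eq_iff)
  then have "X = matrix_inv g ** g ** Y"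
    unfolding X_def by (metis matrix_mul_assoc)
  then have "X = Y" by (simp add: inv)
  then show "X $ 1 $ 1 = a + (a - b) * (g $ 1 $ 2 * g $ 2 $ 1 / D)"
    "X $ 1 $ 2 = (a - b) * (g $ 1 $ 2 * g $ 2 $ 2 / D)"
    "X $ 2 $ 1 = - ((a - b) * (g $ 1 $ 1 * g $ 2 $ 1 / D))"
    "X $ 2 $ 2 = b - (a - b) * (g $ 1 $ 2 * g $ 2 $ 1 / D)"
    by (simp_all add: Y_def)
qed

lemma padic_integers_add: "x \<in> padic_integers \<Longrightarrow> y \<in> padic_integers \<Longrightarrow> x + y \<in> padic_integers"
  using padic_norm_ultra[of x y] by (simp add: padic_integers_def)

lemma padic_integers_minus_iff: "- x \<in> padic_integers \<longleftrightarrow> x \<in> padic_integers"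
  by (simp add: padic_integers_def)

lemma padic_integers_diff: "x \<in> padic_integers \<Longrightarrow> y \<in> padic_integers \<Longrightarrow> x - y \<in> padic_integers"
  using padic_norm_ultra_diff[of x y] by (simp add: padic_integers_def)

lemma padic_integers_mult: "x \<in> padic_integers \<Longrightarrow> y \<in> padic_integers \<Longrightarrow> x * y \<in> padic_integers"
  by (simp add: padic_integers_def padic_norm_mult mult_le_one)

text \<open>The p-adic integers are integrally closed in degree two: if \<open>x\<close> had norm
  above 1, its square would be too large for the right-hand side.\<close>

lemma padic_integers_quadratic_root:
  assumes "s \<in> padic_integers" "q \<in> padic_integers" "x * x = s * x - q"
  shows "x \<in> padic_integers"
proof (rule ccontr)
  assume "x \<notin> padic_integers"
  then have x: "padic_norm x > 1" by (simp add: padic_integers_def)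
  have "padic_norm (s * x - q) \<le> max (padic_norm (s * x)) (padic_norm q)"
    by (rule padic_norm_ultra_diff)
  also have "\<dots> \<le> padic_norm x"
    using assms(1,2) x by (auto simp: padic_integers_def padic_norm_mult intro: mult_left_le_one_le)
  also have "\<dots> < padic_norm x * padic_norm x" using mult_strict_left_mono[OF x less_trans[OF zero_less_one x]] by simp
  finally show False using assms(3) by (metis less_irrefl padic_norm_mult)
qed

text \<open>An integral conjugate has integral trace and determinant, hence integral eigenvalues
  \<open>a\<close> and \<open>b\<close>; integrality of the entries then reduces to that of the
  products \<open>e i j\<close>.\<close>

lemma conjugate_in_det_level_iff:
  fixes a b :: "'p::prime_card padic"
  assumes g: "det g \<noteq> 0" and "a \<noteq> b"
  shows "matrix_inv g ** diag2 a b ** g \<in> det_level m \<longleftrightarrow>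
    a \<in> padic_integers \<and> b \<in> padic_integers \<and> padic_norm (a * b) = real CARD('p) powi (- int m) \<and>
    row_ratio g \<le> 1 / padic_norm (a - b)"
proof -
  define X where "X = matrix_inv g ** diag2 a b ** g"
  define D where "D = det g"
  define e where "e i j = (a - b) * (g $ 1 $ i * g $ 2 $ j / D)" for i j
  have X: "X $ 1 $ 1 = a + e 2 1" "X $ 1 $ 2 = e 2 2" "X $ 2 $ 1 = - e 1 1" "X $ 2 $ 2 = b - e 2 1"
    unfolding X_def e_def D_def using conjugate_diag2[OF g] by blast+
  have D: "D \<noteq> 0" "D = g $ 1 $ 1 * g $ 2 $ 2 - g $ 1 $ 2 * g $ 2 $ 1"
    using g by (simp_all add: D_def det_2)
  \<comment> \<open>Only three of the four products occur in \<open>X\<close>; the missing one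
    differs from \<open>e 2 1\<close> by the integral element \<open>a - b\<close>.\<close>
  have e12: "e 1 2 = e 2 1 + (a - b)"
  proof -
    have "g $ 1 $ 1 * g $ 2 $ 2 / D = g $ 1 $ 2 * g $ 2 $ 1 / D + 1"
      using D(1) by (simp add: field_simps) (simp add: D(2))
    then show ?thesis by (simp add: e_def distrib_left)
  qed
  have detX: "det X = a * b"
  proof -
    have "det g * det X = det (g ** (matrix_inv g ** (diag2 a b ** g)))"
      by (simp add: X_def det_mul matrix_mul_assoc)
    also have "\<dots> = det (diag2 a b ** g)"
      using g by (simp add: matrix_mul_assoc matrix_inv_mult)
    finally show ?thesis using g by (simp add: det_mul det_diag2)
  qed
  \<comment> \<open>The largest norm among the \<open>e i j\<close> is exactly the norm of
    \<open>a - b\<close> times \<open>row_ratio g\<close>.\<close>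
  have ratio: "row_ratio g \<le> 1 / padic_norm (a - b) \<longleftrightarrow> (\<forall>i j. e i j \<in> padic_integers)"
  proof -
    have pos: "padic_norm (a - b) > 0" "padic_norm D > 0" using assms D by auto
    have "padic_norm (e i j) \<le> padic_norm (a - b) * row_ratio g" for i j
    proof -
      have "padic_norm (g $ 1 $ i * g $ 2 $ j) \<le> row_norm (g $ 1) * row_norm (g $ 2)"
        unfolding padic_norm_mult
        using row_norm_le_iff[of "g $ 1" "row_norm (g $ 1)"] row_norm_le_iff[of "g $ 2" "row_norm (g $ 2)"]
        by (intro mult_mono) (auto simp: row_norm_nonneg)
      then show ?thesis
        using pos by (simp add: e_def padic_norm_mult padic_norm_divide row_ratio_def D_def divide_right_mono)
    qed
    moreover obtain i j where "row_norm (g $ 1) * row_norm (g $ 2) = padic_norm (g $ 1 $ i * g $ 2 $ j)"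
      by (rule row_norm_product)
    then have "padic_norm (e i j) = padic_norm (a - b) * row_ratio g"
      by (simp add: e_def padic_norm_mult padic_norm_divide row_ratio_def D_def)
    ultimately have "(\<forall>i j. padic_norm (e i j) \<le> 1) \<longleftrightarrow> padic_norm (a - b) * row_ratio g \<le> 1"
      by (metis order_trans)
    then show ?thesis
      using pos by (simp add: padic_integers_def pos_le_divide_eq mult.commute)
  qed
  have "(\<forall>i j. X $ i $ j \<in> padic_integers) \<longleftrightarrow>
      a \<in> padic_integers \<and> b \<in> padic_integers \<and> (\<forall>i j. e i j \<in> padic_integers)" (is "?L \<longleftrightarrow> ?R")
  proof
    assume L: ?L
    have "X $ 1 $ 1 + X $ 2 $ 2 \<in> padic_integers" using L by (intro padic_integers_add) auto
    then have s: "a + b \<in> padic_integers" by (simp add: X)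
    have "det X \<in> padic_integers"
      unfolding det_2 using L by (intro padic_integers_diff padic_integers_mult) auto
    then have q: "a * b \<in> padic_integers" by (simp add: detX)
    \<comment> \<open>Both are roots of the characteristic polynomial with coefficients
      \<open>a + b\<close> and \<open>a * b\<close>.\<close>
    have a: "a \<in> padic_integers" and b: "b \<in> padic_integers"
      by (rule padic_integers_quadratic_root[OF s q]; simp add: algebra_simps)+
    have e: "e 2 2 \<in> padic_integers" "e 1 1 \<in> padic_integers" "e 2 1 \<in> padic_integers"
      using L X padic_integers_diff[of "X $ 1 $ 1" a] a by (metis padic_integers_minus_iff add_diff_cancel_left')+
    then show ?R
      using a b by (simp add: forall_2 e12 padic_integers_add padic_integers_diff)
  next
    assume ?R
    then show ?L
      by (simp add: forall_2 X padic_integers_add padic_integers_diff padic_integers_minus_iff)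
  qed
  then show ?thesis
    unfolding X_def[symmetric] det_level_def by (auto simp: detX ratio)
qed

section \<open>Volumes\<close>

text \<open>Measurability comes from the normalization: \<open>emeasure\<close> is 0 off the
  sigma-algebra, so a set of measure 1 must belong to it.\<close>

lemma haar_measure_translate:
  assumes "haar_measure G \<mu>" "g \<in> G" "emeasure \<mu> E = 1"
  shows "(\<lambda>h. g ** h) ` E \<in> sets \<mu>" "emeasure \<mu> ((\<lambda>h. g ** h) ` E) = 1"
proof -
  have "E \<in> sets \<mu>" using assms(3) emeasure_notin_sets by fastforce
  then show "emeasure \<mu> ((\<lambda>h. g ** h) ` E) = 1"
    using assms by (simp add: haar_measure_def)
  then show "(\<lambda>h. g ** h) ` E \<in> sets \<mu>" using emeasure_notin_sets by fastforce
qed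

text \<open>
  The union of the \<open>n(t) K\<close> with \<open>|t| \<le> p^j\<close>. It meets every coset \<open>A g\<close> either in a single orbit of
  \<open>A(\<int>\<^sub>p)\<close> or not at all, so the quotient measure of its image equals its Haar measure.
\<close>

definition unipotent_slice :: "nat \<Rightarrow> ('p::prime_card padic^2^2) set" where
  "unipotent_slice j = {g. row_norm (g $ 2) = 1 \<and> padic_norm (det g) = 1 \<and>
     row_norm (g $ 1) \<le> real CARD('p) ^ j}"

abbreviation fraction_translate :: "nat \<Rightarrow> nat \<Rightarrow> ('p::prime_card padic^2^2) set" where
  "fraction_translate j i \<equiv>
     (\<lambda>k. upper_unipotent (of_nat i / of_nat CARD('p) ^ j) ** k) ` GL2_integral"

section \<open>Slices as finite disjoint unions of translates of the maximal compact
  subgroup\<close>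

lemma unipotent_translate_iff:
  "g \<in> (\<lambda>k. upper_unipotent t ** k) ` GL2_integral \<longleftrightarrow>
    row_norm (g $ 1 - t *s g $ 2) \<le> 1 \<and> row_norm (g $ 2) \<le> 1 \<and> padic_norm (det g) = 1"
  (is "?L \<longleftrightarrow> ?R")
proof
  assume ?L
  then show ?R
    by (auto simp: GL2_integral_iff upper_unipotent_mult_rows det_mul det_upper_unipotent)
next
  assume R: ?R
  define k where "k = upper_unipotent (- t) ** g"
  have "k \<in> GL2_integral"
    using R by (simp add: k_def GL2_integral_iff upper_unipotent_mult_rows det_mul det_upper_unipotent)
  moreover have "g = upper_unipotent t ** k"
    by (simp add: k_def vec_eq_iff forall_2 upper_unipotent_mult_rows)
  ultimately show ?L by blast
qed

lemma padic_norm_fraction: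
  "padic_norm (x / of_nat CARD('p) ^ j :: 'p::prime_card padic) = padic_norm x * real CARD('p) ^ j"
  by (simp add: padic_norm_divide padic_norm_power padic_norm_CARD power_inverse) (simp add: divide_inverse)

text \<open>In the Iwasawa form the torus part is integral, and \<open>t\<close> matters only modulo
  the p-adic integers. The fractions i / p^j represent all classes of norm at most p^j.\<close>

lemma unipotent_slice_eq_Union:
  "unipotent_slice j = (\<Union>i<CARD('p::prime_card) ^ j. fraction_translate j i :: ('p padic^2^2) set)"
proof (intro equalityI subsetI)
  fix g :: "'p padic^2^2"
  let ?q = "of_nat CARD('p) ^ j :: 'p padic"
  have "(of_nat CARD('p) :: 'p padic) \<noteq> 0"
    unfolding padic_norm_eq_0_iff[symmetric] padic_norm_CARD using CARD_gt_1[where 'p='p] by simp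
  then have q: "?q \<noteq> 0" by simp
  have pj: "real CARD('p) ^ j > 0" using CARD_gt_1[where 'p='p] by simp
  have pj1: "real CARD('p) ^ j \<ge> 1" using CARD_gt_1[where 'p='p] by simp
  assume "g \<in> unipotent_slice j"
  then have g: "row_norm (g $ 2) = 1" "padic_norm (det g) = 1" "row_norm (g $ 1) \<le> real CARD('p) ^ j"
    by (auto simp: unipotent_slice_def)
  obtain t x y k where xy: "x \<noteq> 0" "y \<noteq> 0" and k: "k \<in> GL2_integral"
    and gk: "g = upper_unipotent t ** diag2 x y ** k"
    using iwasawa_decomposition[of g] g(2) by (metis padic_norm_0 zero_neq_one)
  have xy1: "padic_norm y = 1" "padic_norm x = 1"
    using iwasawa_norms[OF k gk] g by simp_all
  have row1: "row_norm (g $ 1 - t *s g $ 2) \<le> 1"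
    using GL2_integral_row_norm[OF k] xy1
    by (simp add: gk matrix_mul_assoc[symmetric] upper_unipotent_mult_rows diag2_mult_rows row_norm_scale)
  \<comment> \<open>The bottom row has norm 1, so the norm of \<open>t\<close> is that of
    \<open>t *s g $ 2\<close>, a difference of two rows already bounded.\<close>
  have "padic_norm t = row_norm (g $ 1 - (g $ 1 - t *s g $ 2))" using g(1) by (simp add: row_norm_scale)
  also have "\<dots> \<le> real CARD('p) ^ j"
    using row_norm_diff[of "g $ 1" "g $ 1 - t *s g $ 2"] row1 g(3) pj1 by linarith
  finally have "padic_norm t \<le> real CARD('p) ^ j" .
  then have "padic_norm (t * ?q) \<le> 1"
    using pj by (simp add: padic_norm_mult padic_norm_power padic_norm_CARD power_inverse field_simps)
  then obtain i where i: "i < CARD('p) ^ j" "padic_norm (t * ?q - of_nat i) \<le> inverse (real CARD('p) ^ j)"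
    by (rule padic_integer_approx)
  \<comment> \<open>Dividing by p^j scales the error p^(-j) up to at most 1, so replacing
    \<open>t\<close> by the fraction changes the top row by an integral vector.\<close>
  have eq: "t - of_nat i / ?q = (t * ?q - of_nat i) / ?q" using q by (simp add: field_simps)
  have t: "padic_norm (t - of_nat i / ?q) \<le> 1"
    unfolding eq padic_norm_fraction using i(2) pj by (simp add: field_simps)
  have eq': "g $ 1 - (of_nat i / ?q) *s g $ 2 = (g $ 1 - t *s g $ 2) + (t - of_nat i / ?q) *s g $ 2"
    by (simp add: vec_eq_iff algebra_simps)
  have "row_norm ((t - of_nat i / ?q) *s g $ 2) \<le> 1"
    unfolding row_norm_scale using t g(1) by simp
  then have "row_norm (g $ 1 - (of_nat i / ?q) *s g $ 2) \<le> 1"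
    unfolding eq' using row_norm_add row1 by (meson max.boundedI order_trans)
  then show "g \<in> (\<Union>i<CARD('p) ^ j. fraction_translate j i)"
    using i(1) g by (auto simp: unipotent_translate_iff)
next
  fix g :: "'p padic^2^2"
  have pj1: "real CARD('p) ^ j \<ge> 1" using CARD_gt_1[where 'p='p] by simp
  assume "g \<in> (\<Union>i<CARD('p) ^ j. fraction_translate j i)"
  then obtain i k where k: "k \<in> GL2_integral"
    and g: "g = upper_unipotent (of_nat i / of_nat CARD('p) ^ j) ** k" by blast
  have "padic_norm (of_nat i :: 'p padic) \<le> 1"
    using padic_norm_of_nat_le_iff[where 'p='p, of i 0] by (cases "i = 0") auto
  then have "padic_norm (of_nat i / of_nat CARD('p) ^ j :: 'p padic) \<le> real CARD('p) ^ j"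
    by (simp add: padic_norm_fraction mult_left_le_one_le)
  then have "row_norm ((of_nat i / of_nat CARD('p) ^ j) *s k $ 2) \<le> real CARD('p) ^ j"
    using GL2_integral_row_norm[OF k] by (simp add: row_norm_scale)
  then have "row_norm (g $ 1) \<le> real CARD('p) ^ j"
    unfolding g upper_unipotent_mult_rows
    by (intro order_trans[OF row_norm_add] max.boundedI)
      (use GL2_integral_row_norm(1)[OF k] pj1 in simp_all)
  then show "g \<in> unipotent_slice j"
    using k GL2_integral_row_norm[OF k]
    by (simp add: unipotent_slice_def g upper_unipotent_mult_rows det_mul det_upper_unipotent GL2_integral_iff)
qed

text \<open>A common element makes the difference of two fractions integral, so p^j divides the
  difference of numerators below p^j. Proving \<open>i \<le> l\<close> and exchanging the roles
  avoids truncated subtraction.\<close>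

lemma disjoint_fraction_translates:
  "disjoint_family_on (fraction_translate j :: nat \<Rightarrow> ('p::prime_card padic^2^2) set) {..<CARD('p) ^ j}"
proof -
  have le: "i \<le> l" if "g \<in> fraction_translate j i" "g \<in> fraction_translate j l" "i < CARD('p) ^ j"
    for i l and g :: "'p padic^2^2"
  proof (rule ccontr)
    assume il: "\<not> i \<le> l"
    let ?s = "of_nat i / of_nat CARD('p) ^ j :: 'p padic" and ?t = "of_nat l / of_nat CARD('p) ^ j :: 'p padic"
    have g: "row_norm (g $ 1 - ?s *s g $ 2) \<le> 1" "row_norm (g $ 1 - ?t *s g $ 2) \<le> 1"
      using that by (simp_all only: unipotent_translate_iff)
    have g2: "row_norm (g $ 2) = 1"
      using that(1) GL2_integral_row_norm by (auto simp: upper_unipotent_mult_rows)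
    have "(?s - ?t) *s g $ 2 = (g $ 1 - ?t *s g $ 2) - (g $ 1 - ?s *s g $ 2)"
      by (simp add: vec_eq_iff algebra_simps)
    then have "padic_norm (?s - ?t) \<le> 1"
      using row_norm_diff[of "g $ 1 - ?t *s g $ 2" "g $ 1 - ?s *s g $ 2"] g g2
        row_norm_scale[of "?s - ?t" "g $ 2"] by simp
    moreover have "?s - ?t = of_nat (i - l) / of_nat CARD('p) ^ j"
      using il by (simp add: of_nat_diff diff_divide_distrib)
    ultimately have "padic_norm (of_nat (i - l) :: 'p padic) \<le> inverse (real CARD('p) ^ j)"
      using CARD_gt_1[where 'p='p] by (simp add: padic_norm_fraction field_simps)
    then have "CARD('p) ^ j dvd i - l"
      using il by (subst (asm) padic_norm_of_nat_le_iff) auto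
    then show False using il that(3) by (auto dest!: dvd_imp_le)
  qed
  show ?thesis
    unfolding disjoint_family_on_def
  proof (intro ballI impI)
    fix i l assume il: "i \<in> {..<CARD('p) ^ j}" "l \<in> {..<CARD('p) ^ j}" "i \<noteq> l"
    then show "fraction_translate j i \<inter> fraction_translate j l = ({} :: ('p padic^2^2) set)"
      using le by (metis disjoint_iff lessThan_iff order_antisym)
  qed
qed

lemma upper_unipotent_in_GL2: "upper_unipotent t \<in> GL2"
  by (simp add: GL2_iff det_upper_unipotent)

lemma emeasure_unipotent_slice:
  fixes \<mu> :: "('p::prime_card padic^2^2) measure"
  assumes "haar_measure GL2 \<mu>" "emeasure \<mu> GL2_integral = 1"
  shows "unipotent_slice j \<in> sets \<mu>" "emeasure \<mu> (unipotent_slice j) = CARD('p) ^ j"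
proof -
  note T = haar_measure_translate[OF assms(1) upper_unipotent_in_GL2 assms(2)]
  show "unipotent_slice j \<in> sets \<mu>"
    unfolding unipotent_slice_eq_Union using T by auto
  have "emeasure \<mu> (unipotent_slice j) = (\<Sum>i<CARD('p) ^ j. emeasure \<mu> (fraction_translate j i))"
    unfolding unipotent_slice_eq_Union using T
    by (intro sum_emeasure[symmetric] disjoint_fraction_translates) auto
  then show "emeasure \<mu> (unipotent_slice j) = CARD('p) ^ j" using T by simp
qed

section \<open>Volumes in the quotient\<close>

lemma space_quotient_borel: "space (quotient_borel H G) = right_cosets H G"
  unfolding quotient_borel_def by (rule space_measure_of) (auto simp: right_cosets_def)

lemma mat_1_in_torus: "mat 1 \<in> (torus :: ('a::field^2^2) set)"
proof -
  have "mat 1 = diag2 1 (1 :: 'a)" by (simp add: vec_eq_iff forall_2 diag2_def mat_def)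
  then show ?thesis unfolding torus_def by force
qed

text \<open>Since \<open>coset_rep\<close> is an arbitrary choice, invariance of
  \<open>row_ratio\<close> under the torus is what makes it a function on cosets.\<close>

lemma coset_rep_torus:
  assumes "S \<in> right_cosets torus (GL2 :: ('p::prime_card padic^2^2) set)"
  shows "coset_rep S \<in> S" "det (coset_rep S) \<noteq> 0"
    and "g \<in> S \<Longrightarrow> row_ratio g = row_ratio (coset_rep S)"
proof -
  obtain g0 where g0: "g0 \<in> GL2" "S = (\<lambda>h. h ** g0) ` torus"
    using assms by (auto simp: right_cosets_def)
  have "g0 \<in> S" unfolding g0
    by (rule image_eqI[OF _ mat_1_in_torus]) simp
  then show rep: "coset_rep S \<in> S" unfolding coset_rep_def by (rule someI)
  have *: "det g \<noteq> 0 \<and> row_ratio g = row_ratio g0" if "g \<in> S" for g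
    using that g0(1) by (auto simp: g0(2) torus_def row_ratio_diag2_mult det_mul det_diag2 GL2_iff)
  show "det (coset_rep S) \<noteq> 0" using * rep by blast
  show "g \<in> S \<Longrightarrow> row_ratio g = row_ratio (coset_rep S)" using * rep by metis
qed

definition ratio_cosets :: "nat \<Rightarrow> ('p::prime_card padic^2^2) set set" where
  "ratio_cosets j = {S \<in> right_cosets torus GL2. row_ratio (coset_rep S) \<le> real CARD('p) ^ j}"

text \<open>The ratio takes only powers of p as values, so the closed condition is also an open
  one.\<close>

lemma row_ratio_le_iff_less:
  fixes g :: "'p::prime_card padic^2^2"
  assumes "det g \<noteq> 0"
  shows "row_ratio g \<le> real CARD('p) ^ j \<longleftrightarrow> row_ratio g < real CARD('p) ^ Suc j"
proof -
  obtain n where "row_ratio g = real CARD('p) ^ n" by (rule row_ratio_eq_power[OF assms])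
  then show ?thesis using CARD_gt_1[where 'p='p]
    by (simp only: power_increasing_iff power_strict_increasing_iff) auto
qed

lemma ratio_cosets_in_sets:
  "ratio_cosets j \<in> sets (quotient_borel torus (GL2 :: ('p::prime_card padic^2^2) set))"
proof -
  \<comment> \<open>Clearing the denominator leaves a strict inequality between functions continuous
    on all matrices, singular ones included.\<close>
  define U :: "('p padic^2^2) set" where
    "U = {g. row_norm (g $ 1) * row_norm (g $ 2) < real CARD('p) ^ Suc j * padic_norm (det g)}"
  have "open U"
    unfolding U_def row_norm_def det_2
    by (intro open_Collect_less continuous_intros)
  have mem: "g \<in> U \<longleftrightarrow> row_ratio g \<le> real CARD('p) ^ j" if "det g \<noteq> 0" for g
    unfolding row_ratio_le_iff_less[OF that] using that
    by (simp add: U_def row_ratio_def pos_divide_less_eq)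
  have "\<Union>(ratio_cosets j) = GL2 \<inter> U"
  proof (intro equalityI subsetI)
    fix g :: "'p padic^2^2" assume "g \<in> \<Union>(ratio_cosets j)"
    then obtain S where S: "S \<in> right_cosets torus GL2" "row_ratio (coset_rep S) \<le> real CARD('p) ^ j" "g \<in> S"
      by (auto simp: ratio_cosets_def)
    then have "det g \<noteq> 0"
      by (auto simp: right_cosets_def torus_def det_mul det_diag2 GL2_iff)
    then show "g \<in> GL2 \<inter> U"
      using mem coset_rep_torus(3)[OF S(1,3)] S(2) by (simp add: GL2_iff)
  next
    fix g :: "'p padic^2^2" assume g: "g \<in> GL2 \<inter> U"
    define S where "S = (\<lambda>h. h ** g) ` torus"
    have S: "S \<in> right_cosets torus GL2" using g by (auto simp: S_def right_cosets_def)
    have gS: "g \<in> S" unfolding S_def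
      by (rule image_eqI[OF _ mat_1_in_torus]) simp
    have "S \<in> ratio_cosets j"
      using S g mem[of g] coset_rep_torus(3)[OF S gS] by (simp add: ratio_cosets_def GL2_iff)
    then show "g \<in> \<Union>(ratio_cosets j)" using gS by blast
  qed
  then have "openin (top_of_set GL2) (\<Union>(ratio_cosets j) :: ('p padic^2^2) set)"
    using \<open>open U\<close> by (simp add: openin_open_Int)
  then show ?thesis
    unfolding quotient_borel_def
    by (subst sets_measure_of) (auto simp: ratio_cosets_def right_cosets_def)
qed

text \<open>If \<open>g\<close> has Iwasawa entries \<open>x\<close> and \<open>y\<close>, the norm
  conditions on the bottom row and the determinant force \<open>u * x\<close> and
  \<open>v * y\<close> to be units. What remains of the slice condition concerns
  \<open>row_ratio g\<close> alone.\<close>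

lemma torus_translate_slice:
  fixes g :: "'p::prime_card padic^2^2"
  assumes "det g \<noteq> 0"
  obtains h0 where "h0 \<in> torus"
    "{h \<in> torus. h ** g \<in> unipotent_slice j} =
      (if row_ratio g \<le> real CARD('p) ^ j then (\<lambda>h. h0 ** h) ` torus_integral else {})"
proof -
  obtain t x y k where xy: "x \<noteq> 0" "y \<noteq> 0" and k: "k \<in> GL2_integral"
    and gk: "g = upper_unipotent t ** diag2 x y ** k"
    using iwasawa_decomposition[OF assms] by metis
  note n = iwasawa_norms[OF k gk]
  have mult: "diag2 (inverse x) (inverse y) ** diag2 u v = diag2 (u / x) (v / y)" for u v
    by (simp add: vec_eq_iff forall_2 diag2_mult_rows) (simp add: diag2_def divide_inverse mult.commute)
  have iff: "diag2 u v ** g \<in> unipotent_slice j \<longleftrightarrow>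
      padic_norm (u * x) = 1 \<and> padic_norm (v * y) = 1 \<and> row_ratio g \<le> real CARD('p) ^ j" for u v
  proof -
    have "diag2 u v ** g \<in> unipotent_slice j \<longleftrightarrow> padic_norm v * padic_norm y = 1 \<and>
        padic_norm u * padic_norm v * (padic_norm x * padic_norm y) = 1 \<and>
        padic_norm u * row_norm (g $ 1) \<le> real CARD('p) ^ j"
      by (simp add: n[symmetric] unipotent_slice_def diag2_mult_rows row_norm_scale det_mul det_diag2 padic_norm_mult)
    also have "\<dots> \<longleftrightarrow> padic_norm v * padic_norm y = 1 \<and> padic_norm u * padic_norm x = 1 \<and>
        padic_norm u * row_norm (g $ 1) \<le> real CARD('p) ^ j"
    proof -
      have eq: "padic_norm u * padic_norm v * (padic_norm x * padic_norm y) =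
          (padic_norm v * padic_norm y) * (padic_norm u * padic_norm x)" by (simp add: mult_ac)
      show ?thesis unfolding eq by auto
    qed
    also have "\<dots> \<longleftrightarrow> padic_norm v * padic_norm y = 1 \<and> padic_norm u * padic_norm x = 1 \<and>
        row_ratio g \<le> real CARD('p) ^ j"
    proof -
      \<comment> \<open>The norm of \<open>u\<close> is the inverse of that of \<open>x\<close>,
        which is the bottom row norm over the determinant norm.\<close>
      have "padic_norm u * row_norm (g $ 1) = row_ratio g" if "padic_norm u * padic_norm x = 1"
      proof -
        have "padic_norm u = 1 / padic_norm x" using that xy(1) by (simp add: field_simps)
        then show ?thesis unfolding row_ratio_def n(2)[symmetric] n(1)[symmetric] using xy by simp
      qed
      then show ?thesis by auto
    qed
    finally show ?thesis by (auto simp: padic_norm_mult)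
  qed
  show ?thesis
  proof
    \<comment> \<open>The witness cancels the torus part of \<open>g\<close> up to units.\<close>
    show "diag2 (inverse x) (inverse y) \<in> torus"
      using xy unfolding torus_def by (metis (mono_tags, lifting) CollectI inverse_nonzero_iff_nonzero)
    have "(\<lambda>h. diag2 (inverse x) (inverse y) ** h) ` torus_integral =
        {diag2 u v | u v. u \<noteq> 0 \<and> v \<noteq> 0 \<and> padic_norm (u * x) = 1 \<and> padic_norm (v * y) = 1}"
    proof (intro equalityI subsetI)
      fix h assume "h \<in> (\<lambda>h. diag2 (inverse x) (inverse y) ** h) ` torus_integral"
      then obtain u v where "h = diag2 (u / x) (v / y)" "padic_norm u = 1" "padic_norm v = 1"
        by (auto simp: torus_integral_def mult)
      moreover from this have "u \<noteq> 0" "v \<noteq> 0" by auto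
      ultimately show "h \<in> {diag2 u v | u v. u \<noteq> 0 \<and> v \<noteq> 0 \<and> padic_norm (u * x) = 1 \<and> padic_norm (v * y) = 1}"
        using xy by (intro CollectI exI[of _ "u / x"] exI[of _ "v / y"]) auto
    next
      fix h assume "h \<in> {diag2 u v | u v. u \<noteq> 0 \<and> v \<noteq> 0 \<and> padic_norm (u * x) = 1 \<and> padic_norm (v * y) = 1}"
      then obtain u v where uv: "h = diag2 u v" "padic_norm (u * x) = 1" "padic_norm (v * y) = 1" by auto
      then have "h = diag2 (inverse x) (inverse y) ** diag2 (u * x) (v * y)" using xy by (simp add: mult)
      then show "h \<in> (\<lambda>h. diag2 (inverse x) (inverse y) ** h) ` torus_integral"
        using uv by (auto simp: torus_integral_def)
    qed
    moreover have "{h \<in> torus. h ** g \<in> unipotent_slice j} =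
        {diag2 u v | u v. u \<noteq> 0 \<and> v \<noteq> 0 \<and> diag2 u v ** g \<in> unipotent_slice j}"
      by (auto simp: torus_def)
    ultimately show "{h \<in> torus. h ** g \<in> unipotent_slice j} =
      (if row_ratio g \<le> real CARD('p) ^ j then (\<lambda>h. diag2 (inverse x) (inverse y) ** h) ` torus_integral else {})"
      by (auto simp: iff)
  qed
qed

text \<open>The quotient formula is applied to the indicator of the slice. Its inner integral is the
  volume of a translate of \<open>torus_integral\<close> or of the empty set, hence 1 or 0.\<close>

lemma emeasure_ratio_cosets:
  fixes \<mu>G \<mu>A :: "('p::prime_card padic^2^2) measure"
  assumes "haar_measure GL2 \<mu>G" "emeasure \<mu>G GL2_integral = 1"
    and "haar_measure torus \<mu>A" "emeasure \<mu>A torus_integral = 1"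
    and "quotient_measure torus GL2 \<mu>A \<mu>G \<nu>"
  shows "emeasure \<nu> (ratio_cosets j) = CARD('p) ^ j"
proof -
  have sets: "sets \<nu> = sets (quotient_borel torus GL2)"
    using assms(5) by (simp add: quotient_measure_def)
  then have space: "space \<nu> = right_cosets torus GL2"
    using sets_eq_imp_space_eq space_quotient_borel by blast
  have spaceA: "space \<mu>A = torus"
    using assms(3) sets_eq_imp_space_eq[of \<mu>A "restrict_space borel torus"]
    by (simp add: haar_measure_def space_restrict_space)
  note slice = emeasure_unipotent_slice[OF assms(1,2), of j]
  have inner: "(\<integral>\<^sup>+ h. indicator (unipotent_slice j) (h ** coset_rep S) \<partial>\<mu>A) = indicator (ratio_cosets j) S"
    if S: "S \<in> space \<nu>" for S
  proof -
    let ?g = "coset_rep S"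
    have Sc: "S \<in> right_cosets torus GL2" using S space by simp
    obtain h0 where h0: "h0 \<in> torus" and eq: "{h \<in> torus. h ** ?g \<in> unipotent_slice j} =
        (if row_ratio ?g \<le> real CARD('p) ^ j then (\<lambda>h. h0 ** h) ` torus_integral else {})"
      by (rule torus_translate_slice[OF coset_rep_torus(2)[OF Sc]])
    note T = haar_measure_translate[OF assms(3) h0 assms(4)]
    have "(\<integral>\<^sup>+ h. indicator (unipotent_slice j) (h ** ?g) \<partial>\<mu>A) =
        (\<integral>\<^sup>+ h. indicator {h \<in> torus. h ** ?g \<in> unipotent_slice j} h \<partial>\<mu>A)"
      by (rule nn_integral_cong) (simp add: spaceA indicator_def)
    also have "\<dots> = indicator (ratio_cosets j) S"
      unfolding eq using T Sc by (simp add: ratio_cosets_def)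
    finally show ?thesis .
  qed
  have "emeasure \<mu>G (unipotent_slice j) = (\<integral>\<^sup>+ g. indicator (unipotent_slice j) g \<partial>\<mu>G)"
    using slice(1) by simp
  also have "\<dots> = (\<integral>\<^sup>+ S. (\<integral>\<^sup>+ h. indicator (unipotent_slice j) (h ** coset_rep S) \<partial>\<mu>A) \<partial>\<nu>)"
    using assms(5) slice(1) unfolding quotient_measure_def by (meson borel_measurable_indicator)
  also have "\<dots> = (\<integral>\<^sup>+ S. indicator (ratio_cosets j) S \<partial>\<nu>)"
    by (rule nn_integral_cong) (rule inner)
  also have "\<dots> = emeasure \<nu> (ratio_cosets j)"
    using ratio_cosets_in_sets sets by (intro nn_integral_indicator) blast
  finally show ?thesis using slice(2) by simp
qed

text \<open>Discrete layer-cake formula: if the ratio is p^n with \<open>n \<le> k\<close>, exactly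
  the \<open>n\<close> indices below \<open>n\<close> contribute. The logarithm thus becomes a
  finite combination of indicators.\<close>

lemma ln_row_ratio_eq_sum:
  fixes g :: "'p::prime_card padic^2^2"
  assumes "det g \<noteq> 0" "row_ratio g \<le> real CARD('p) ^ k"
  shows "ln (row_ratio g) = (\<Sum>j<k. if row_ratio g \<le> real CARD('p) ^ j then 0 else ln (real CARD('p)))"
proof -
  obtain n where n: "row_ratio g = real CARD('p) ^ n" by (rule row_ratio_eq_power[OF assms(1)])
  have le: "real CARD('p) ^ n \<le> real CARD('p) ^ j \<longleftrightarrow> n \<le> j" for j
    using CARD_gt_1[where 'p='p] by (rule power_increasing_iff)
  have "{j. j < k \<and> \<not> n \<le> j} = {..<n}" using assms(2) le[of k] by (auto simp: n)
  then show ?thesis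
    using CARD_gt_1[where 'p='p] unfolding n le
    by (simp add: ln_realpow sum.If_cases Int_def Collect_neg_eq[symmetric])
qed

text \<open>Integrability is asserted as well, because the Bochner integral in \<open>wOrb\<close>
  is 0 by convention for functions that are not integrable.\<close>

theorem theorem5p2:
  fixes a b :: "'p::prime_card padic" and m :: nat
    and \<mu>G \<mu>A :: "('p padic^2^2) measure"
    and \<nu> :: "('p padic^2^2) set measure"
  assumes "a \<noteq> 0" and "b \<noteq> 0" and "a \<noteq> b"
    and "haar_measure GL2 \<mu>G" and "emeasure \<mu>G GL2_integral = 1"
    and "haar_measure torus \<mu>A" and "emeasure \<mu>A torus_integral = 1"
    and "quotient_measure torus GL2 \<mu>A \<mu>G \<nu>"
  shows "integrable \<nu> (\<lambda>S. wOrb_integrand (indicator (det_level m)) (diag2 a b) (coset_rep S)) \<and>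
    (if a \<in> padic_integers \<and> b \<in> padic_integers \<and>
        padic_norm (a * b) = real CARD('p) powi (- int m)
     then wOrb \<nu> (indicator (det_level m)) (diag2 a b) =
        2 / padic_norm (a - b) *
          (ln (padic_norm (a - b)) +
           (\<Sum>j = 1..padic_val (a - b). ln (real CARD('p)) / real CARD('p) powi j))
     else wOrb \<nu> (indicator (det_level m)) (diag2 a b) = 0)"
proof -
  let ?p = "real CARD('p)"
  let ?f = "\<lambda>S. wOrb_integrand (indicator (det_level m)) (diag2 a b) (coset_rep S)"
  let ?C = "a \<in> padic_integers \<and> b \<in> padic_integers \<and> padic_norm (a * b) = ?p powi (- int m)"
  have sets: "sets \<nu> = sets (quotient_borel torus GL2)"
    using assms(8) by (simp add: quotient_measure_def)
  then have space: "space \<nu> = right_cosets torus GL2"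
    using sets_eq_imp_space_eq space_quotient_borel by blast
  have f: "?f S = (if ?C \<and> row_ratio (coset_rep S) \<le> 1 / padic_norm (a - b)
      then - 2 * ln (row_ratio (coset_rep S)) else 0)" if "S \<in> space \<nu>" for S
  proof -
    have d: "det (coset_rep S) \<noteq> 0" using coset_rep_torus(2) that space by blast
    show ?thesis
      unfolding wOrb_integrand_def weight_eq_row_ratio[OF d]
      by (simp add: indicator_def conjugate_in_det_level_iff[OF d \<open>a \<noteq> b\<close>])
  qed
  show ?thesis
  proof (cases ?C)
    case False
    then have f0: "?f S = 0" if "S \<in> space \<nu>" for S using f[OF that] by argo
    have "integrable \<nu> ?f" using Bochner_Integration.integrable_cong[of \<nu> \<nu> ?f "\<lambda>_. 0"] f0 by simp
    moreover have "wOrb \<nu> (indicator (det_level m)) (diag2 a b) = 0"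
      unfolding wOrb_def using Bochner_Integration.integral_cong[of \<nu> \<nu> ?f "\<lambda>_. 0"] f0 by simp
    ultimately show ?thesis unfolding if_not_P[OF False] by blast
  next
    case True
    have p1: "?p > 1" by (rule CARD_gt_1)
    obtain v where v: "padic_norm (a - b) = ?p powi (- v)"
      using padic_norm_eq_powi[of "a - b"] \<open>a \<noteq> b\<close> by auto
    \<comment> \<open>Integrality of \<open>a - b\<close> makes its valuation nonnegative, so it can
      serve as a natural number bound \<open>k\<close>.\<close>
    have "a - b \<in> padic_integers" using True padic_integers_diff by blast
    then have "?p powi (- v) \<le> 1" using v by (simp add: padic_integers_def)
    have "v \<ge> 0"
    proof (rule ccontr)
      assume "\<not> v \<ge> 0"
      then have "?p powi 0 < ?p powi (- v)" using p1 by (intro power_int_strict_increasing) auto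
      then show False using \<open>?p powi (- v) \<le> 1\<close> by simp
    qed
    then obtain k :: nat where k: "v = int k" using nonneg_int_cases by blast
    have norm: "padic_norm (a - b) = inverse (?p ^ k)" by (simp add: v k power_int_minus)
    have val: "padic_val (a - b) = int k" using padic_val_eqI[OF v] k by simp
    define Q where "Q j = (ratio_cosets j :: ('p padic^2^2) set set)" for j
    have Qs: "Q j \<in> sets \<nu>" for j using ratio_cosets_in_sets sets by (simp add: Q_def)
    have Qe: "emeasure \<nu> (Q j) = ennreal (?p ^ j)" for j
      using emeasure_ratio_cosets[OF assms(4-8), of j]
      by (simp add: Q_def ennreal_of_nat_eq_real_of_nat flip: of_nat_power)
    have Qm: "measure \<nu> (Q j) = ?p ^ j" for j
      using Qe[of j] by (simp add: measure_def)
    have Qi: "integrable \<nu> (indicator (Q j) :: _ \<Rightarrow> real)" for j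
      using Qs Qe by (simp add: integrable_indicator_iff)
    \<comment> \<open>On \<open>Q k\<close> this is the layer-cake form of the weight; off
      \<open>Q k\<close> every indicator vanishes, as the sets \<open>Q j\<close> increase with
      \<open>j\<close>. Only the volumes of the \<open>Q j\<close> enter its integral.\<close>
    define \<phi> where "\<phi> S = - 2 * ln ?p * (\<Sum>j<k. indicator (Q k) S - indicator (Q j) S :: real)" for S
    have f\<phi>: "?f S = \<phi> S" if S: "S \<in> space \<nu>" for S
    proof -
      let ?g = "coset_rep S"
      have d: "det ?g \<noteq> 0" using coset_rep_torus(2) that space by blast
      have Q: "S \<in> Q j \<longleftrightarrow> row_ratio ?g \<le> ?p ^ j" for j
        using S space by (simp add: Q_def ratio_cosets_def)
      show ?thesis
      proof (cases "S \<in> Q k")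
        case in_Q: True
        then have "ln (row_ratio ?g) = (\<Sum>j<k. if S \<in> Q j then 0 else ln ?p)"
          using ln_row_ratio_eq_sum[OF d] by (simp add: Q)
        also have "\<dots> = ln ?p * (\<Sum>j<k. indicator (Q k) S - indicator (Q j) S)"
          unfolding sum_distrib_left using in_Q by (intro sum.cong) auto
        finally show ?thesis using f[OF S] True in_Q by (simp add: Q norm \<phi>_def field_simps)
      next
        case False
        then have "S \<notin> Q j" if "j < k" for j
          using power_increasing[of j k ?p] that p1 unfolding Q by linarith
        then show ?thesis using f[OF S] False by (simp add: Q norm \<phi>_def field_simps)
      qed
    qed
    have int\<phi>: "integrable \<nu> \<phi>"
      unfolding \<phi>_def by (intro integrable_mult_right Bochner_Integration.integrable_sum
          Bochner_Integration.integrable_diff Qi)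
    have "integrable \<nu> ?f"
      using Bochner_Integration.integrable_cong[of \<nu> \<nu> ?f \<phi>] f\<phi> int\<phi> by simp
    moreover have "wOrb \<nu> (indicator (det_level m)) (diag2 a b) =
        2 / padic_norm (a - b) *
          (ln (padic_norm (a - b)) + (\<Sum>j = 1..padic_val (a - b). ln ?p / ?p powi j))"
    proof -
      have "wOrb \<nu> (indicator (det_level m)) (diag2 a b) = integral\<^sup>L \<nu> \<phi>"
        unfolding wOrb_def using f\<phi> by (intro Bochner_Integration.integral_cong) auto
      also have "\<dots> = - 2 * ln ?p * (\<Sum>j<k. ?p ^ k - ?p ^ j)"
        unfolding \<phi>_def using Qi Qs Qm
        by (simp add: Bochner_Integration.integral_sum Bochner_Integration.integral_diff)
      \<comment> \<open>The \<open>k\<close> copies of p^k produce the logarithm of the norm of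
        \<open>a - b\<close>, and each p^j is p^k divided by p^(k - j).\<close>
      also have "\<dots> = 2 * ?p ^ k * (ln (inverse (?p ^ k)) + (\<Sum>j<k. ln ?p / ?p ^ (k - j)))"
      proof -
        have "ln ?p * ?p ^ j = ?p ^ k * (ln ?p / ?p ^ (k - j))" if "j < k" for j
          using p1 that by (simp add: field_simps flip: power_add)
        then have "(\<Sum>j<k. ln ?p * ?p ^ j) = ?p ^ k * (\<Sum>j<k. ln ?p / ?p ^ (k - j))"
          by (simp add: sum_distrib_left)
        then show ?thesis
          using p1 by (simp add: ln_inverse ln_realpow sum_subtractf sum_distrib_left algebra_simps)
      qed
      \<comment> \<open>Reversal of the index takes 0, ..., k - 1 to k, ..., 1; the target range
        consists of integers because \<open>padic_val\<close> does.\<close>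
      also have "(\<Sum>j<k. ln ?p / ?p ^ (k - j)) = (\<Sum>j = 1..int k. ln ?p / ?p powi j)"
        by (rule sum.reindex_bij_witness[of _ "\<lambda>j. k - nat j" "\<lambda>j. int (k - j)"])
          (auto simp: power_int_def nat_diff_distrib)
      finally show ?thesis by (simp add: norm val divide_inverse)
    qed
    ultimately show ?thesis unfolding if_P[OF True] by blast
  qed
qed

end
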